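(* Let $\alpha_R,\alpha_F\in[0,1)$, let $T_{\rm D}:\mathbb{R}\rightrightarrows\mathbb{R}$ be monotone and outer semicontinuous, and let $T_{\rm NPN}:\mathbb{R}^2\rightrightarrows\mathbb{R}^2$ be the Ebers--Moll transistor operator $$T_{\rm NPN}\begin{pmatrix} v_1 \\ v_2 \end{pmatrix}=\left\{\begin{pmatrix} 1 & -\alpha_R \\ -\alpha_F & 1 \end{pmatrix}\begin{pmatrix} u_1 \\ u_2 \end{pmatrix}: u_1\in T_{\rm D}(v_1),\ u_2\in T_{\rm D}(v_2)\right\}.$$ Let $r>0$, $v_{\rm in}\in\mathbb{R}$, $v_+>0$, and let $R_C,R_E:\mathbb{R}\rightrightarrows\mathbb{R}$ be outer semicontinuous. Set $$R=R_C\times R_E,\quad G=T_{\rm NPN}+\tfrac1r\mathrm{id},\quad L=I_2,\quad s_v=\begin{pmatrix} v_+-v_{\rm in} \\ -v_{\rm in} \end{pmatrix},\quad s_i=0,$$ and consider the problem of finding $(i,v)\in\mathbb{R}^2\times\mathbb{R}^2$ such that $$0\in\begin{bmatrix} R(i) \\ G(v) \end{bmatrix}+\begin{bmatrix} 0 & L^\top \\ -L & 0 \end{bmatrix}\begin{bmatrix} i \\ v \end{bmatrix}+\begin{bmatrix} s_v \\ s_i \end{bmatrix}.\qquad(\ast)$$ Suppose that one of the following holds: (i) $R_C$ and $R_E$ are $\sigma$-monotone for some $\sigma>\frac{r(\sqrt2-1)}{2}$ and $$\gamma\in(0,1/\underline\tau),\quad\tau\in(\underline\tau,1/\gamma),\quad\lambda\in\bigl(0,2(1-\underline\tau/\tau)\bigr),\qquad\text{where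 }\underline\tau=-\frac{\sigma r(1-\sqrt2)}{r(1-\sqrt2)+2\sigma};$$ (ii) $R_C$ and $R_E$ are $\left(\frac98r,-\frac{1}{8r}\right)$-semimonotone and $$\gamma\in\left(\tfrac{5-\sqrt{10}}{9r},\tfrac{5+\sqrt{10}}{9r}\right),\quad\tau\in\left(\tfrac{9r(6r\gamma-1)}{51r\gamma-10},\tfrac1\gamma\right),\quad\lambda\in\left(0,\,2\left(1+\Delta_{\gamma,\tau}-\sqrt{\Delta_{\gamma,\tau}^2-\tfrac{3}{20\gamma\tau}(1-\gamma\tau)}\right)\right),$$ where $\Delta_{\gamma,\tau}=-\frac{1}{12r\gamma}-\frac{9r}{20\tau}$. Then any sequence $(i^k,v^k)_{k\in\mathbb{N}}$ generated by the Chambolle--Pock algorithm for $(\ast)$ with stepsizes $\gamma$ and $\tau$ and relaxation parameter $\lambda$ converges to a solution of $(\ast)$.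
   Context: For a set-valued operator $A:\mathbb{R}^n\rightrightarrows\mathbb{R}^n$, its graph is $\operatorname{gph}A=\{(x,u): u\in A(x)\}$. $A$ is outer semicontinuous if $\operatorname{gph}A$ is closed. For $\mu,\rho\in\mathbb{R}$, $A$ is $(\mu,\rho)$-semimonotone if $\langle x-y,u-v\rangle\ge\mu\|x-y\|^2+\rho\|u-v\|^2$ for all $(x,u),(y,v)\in\operatorname{gph}A$; it is $\sigma$-monotone if it is $(\sigma,0)$-semimonotone and monotone if it is $(0,0)$-semimonotone. $(R_C\times R_E)(i_1,i_2)=R_C(i_1)\times R_E(i_2)$; $\mathrm{id}$ is the identity and $I_2$ the $2\times2$ identity matrix. The $\gamma$-resolvent of $A$ is the (possibly set-valued, possibly not everywhere defined) operator $J_{\gamma A}=(\mathrm{id}+\gamma A)^{-1}$, i.e. $p\in J_{\gamma A}(x)$ iff $x\in p+\gamma A(p)$. Chambolle--Pock algorithm for $(\ast)$: with $\tilde R(i)=R(i)+s_v$ and $\tilde G(v)=G(v)+s_i$, stepsizes $\gamma,\tau>0$, relaxation parameter $\lambda>0$ and an arbitrary initial guess $(i^0,v^0)\in\mathbb{R}^2\times\mathbb{R}^2$, a sequence $(i^k,v^k)_{k\in\mathbb{N}}$ is generated by the algorithm if for all $k\in\mathbb{N}$ there are $\bar i^k,\bar v^k$ with $$\bar i^k\in J_{\gamma\tilde R}\bigl(i^k-\gamma L^\top v^k\bigr),\quad\bar v^k\in J_{\tau\tilde G}\bigl(v^k+\tau L(2\bar i^k-i^k)\bigr),\quad i^{k+1}=i^k+\lambda(\bar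 i^k-i^k),\quad v^{k+1}=v^k+\lambda(\bar v^k-v^k).$$ *)

theory Defs
  imports "HOL-Analysis.Analysis"
begin

text \<open>A set-valued operator from \<open>'a\<close> to \<open>'b\<close> is a function \<open>'a \<Rightarrow> 'b set\<close>; the value \<open>{}\<close> is
  allowed. Sums of such values are Minkowski sums.\<close>

definition gph :: "('a \<Rightarrow> 'b set) \<Rightarrow> ('a \<times> 'b) set" where
  "gph A = {(x, u). u \<in> A x}"

definition outer_semicontinuous ::
    "('a::euclidean_space \<Rightarrow> 'a set) \<Rightarrow> bool" where
  "outer_semicontinuous A \<longleftrightarrow> closed (gph A)"

definition semimonotone :: "real \<Rightarrow> real \<Rightarrow> ('a::euclidean_space \<Rightarrow> 'a set) \<Rightarrow> bool" where
  "semimonotone \<mu> \<rho> A \<longleftrightarrow>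
     (\<forall>(x, u) \<in> gph A. \<forall>(y, v) \<in> gph A.
        (x - y) \<bullet> (u - v) \<ge> \<mu> * (norm (x - y))\<^sup>2 + \<rho> * (norm (u - v))\<^sup>2)"

definition strongly_monotone_op :: "real \<Rightarrow> ('a::euclidean_space \<Rightarrow> 'a set) \<Rightarrow> bool" where
  "strongly_monotone_op \<sigma> A \<longleftrightarrow> semimonotone \<sigma> 0 A"

definition monotone_op :: "('a::euclidean_space \<Rightarrow> 'a set) \<Rightarrow> bool" where
  "monotone_op A \<longleftrightarrow> semimonotone 0 0 A"

definition resolvent ::
    "real \<Rightarrow> ('a::euclidean_space \<Rightarrow> 'a set) \<Rightarrow> 'a \<Rightarrow> 'a set" where
  "resolvent \<gamma> A x = {p. x \<in> {p} + (*\<^sub>R) \<gamma> ` A p}"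

definition prod_op :: "(real \<Rightarrow> real set) \<Rightarrow> (real \<Rightarrow> real set) \<Rightarrow> real^2 \<Rightarrow> (real^2) set" where
  "prod_op A B x = {u. u $ 1 \<in> A (x $ 1) \<and> u $ 2 \<in> B (x $ 2)}"

definition ebers_moll :: "real \<Rightarrow> real \<Rightarrow> (real \<Rightarrow> real set) \<Rightarrow> real^2 \<Rightarrow> (real^2) set" where
  "ebers_moll \<alpha>\<^sub>R \<alpha>\<^sub>F T v =
     {(vector [vector [1, - \<alpha>\<^sub>R], vector [- \<alpha>\<^sub>F, 1]] :: real^2^2) *v vector [u\<^sub>1, u\<^sub>2] |u\<^sub>1 u\<^sub>2.
        u\<^sub>1 \<in> T (v $ 1) \<and> u\<^sub>2 \<in> T (v $ 2)}"

text \<open>The operator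
  \<open>(i, v) \<mapsto> R i \<times> G v + (L\<^sup>T v, - L i) + (s\<^sub>v, s\<^sub>i)\<close>,
  whose zeros are the primal-dual solutions.\<close>

definition primal_dual_op ::
    "(real^'n \<Rightarrow> (real^'n) set) \<Rightarrow> (real^'m \<Rightarrow> (real^'m) set) \<Rightarrow> real^'n^'m \<Rightarrow> real^'n \<Rightarrow> real^'m
      \<Rightarrow> (real^'n) \<times> (real^'m) \<Rightarrow> ((real^'n) \<times> (real^'m)) set" where
  "primal_dual_op R G L s\<^sub>v s\<^sub>i z =
     (case z of (i, v) \<Rightarrow> R i \<times> G v + {(transpose L *v v, - (L *v i))} + {(s\<^sub>v, s\<^sub>i)})"

definition primal_dual_solution ::
    "(real^'n \<Rightarrow> (real^'n) set) \<Rightarrow> (real^'m \<Rightarrow> (real^'m) set) \<Rightarrow> real^'n^'m \<Rightarrow> real^'n \<Rightarrow> real^'m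
      \<Rightarrow> (real^'n) \<times> (real^'m) \<Rightarrow> bool" where
  "primal_dual_solution R G L s\<^sub>v s\<^sub>i z \<longleftrightarrow> 0 \<in> primal_dual_op R G L s\<^sub>v s\<^sub>i z"

text \<open>The resolvents may be empty or multivalued, so being generated by the algorithm is a
  property of a sequence: some admissible choice of \<open>ib\<close>, \<open>vb\<close> must exist at every step. The
  initial point \<open>(i 0, v 0)\<close> is unconstrained.\<close>

definition chambolle_pock ::
    "(real^'n \<Rightarrow> (real^'n) set) \<Rightarrow> (real^'m \<Rightarrow> (real^'m) set) \<Rightarrow> real^'n^'m \<Rightarrow> real^'n \<Rightarrow> real^'m
      \<Rightarrow> real \<Rightarrow> real \<Rightarrow> real \<Rightarrow> (nat \<Rightarrow> real^'n) \<Rightarrow> (nat \<Rightarrow> real^'m) \<Rightarrow> bool" where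
  "chambolle_pock R G L s\<^sub>v s\<^sub>i \<gamma> \<tau> relax i v \<longleftrightarrow>
     (\<forall>k. \<exists>ib vb.
        ib \<in> resolvent \<gamma> (\<lambda>x. R x + {s\<^sub>v}) (i k - \<gamma> *\<^sub>R (transpose L *v v k)) \<and>
        vb \<in> resolvent \<tau> (\<lambda>y. G y + {s\<^sub>i}) (v k + \<tau> *\<^sub>R (L *v (2 *\<^sub>R ib - i k))) \<and>
        i (Suc k) = i k + relax *\<^sub>R (ib - i k) \<and>
        v (Suc k) = v k + relax *\<^sub>R (vb - v k))"

end

theory Submission
  imports Defs
begin

text \<open>
  Write \<open>ib\<close>, \<open>vb\<close> for the resolvent values at \<open>(i, v)\<close> and \<open>e = (i - ib, v - vb)\<close> for the
  residual. For \<open>L = I\<close> the algorithm is a relaxed proximal point iteration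
  preconditioned by the matrix \<open>P = [[1/\<gamma>, -1], [-1, 1/\<tau>]]\<close>, which is positive definite exactly
  because \<open>\<gamma> \<tau> < 1\<close>: the vector \<open>P e\<close> belongs to the primal-dual operator at \<open>(ib, vb)\<close>. In the
  norm of \<open>P\<close> (\<open>cp_energy\<close>) the difference of two relaxed steps satisfies an exact identity
  (\<open>cp_energy_relaxed_step\<close>) whose dissipation is the pairing of \<open>(ib, vb)\<close> with \<open>P e\<close>, which
  semimonotonicity bounds from below, plus \<open>1 - \<lambda>/2\<close> times the energy of \<open>e\<close>.

  The semimonotonicity constants of \<open>R\<close> and \<open>G\<close> are partly negative, but they enter crosswise: a
  negative constant of \<open>R\<close> for its values is compensated by the positive constant of \<open>G\<close> for its
  arguments, and conversely. What then remains to be absorbed are multiples \<open>\<kappa>\<^sub>p\<close> and \<open>\<kappa>\<^sub>q\<close> of the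
  squared components of \<open>P e\<close>; for given \<open>\<gamma>\<close> and \<open>\<tau>\<close>, the energy of \<open>e\<close> absorbs them with a margin
  precisely when \<open>\<lambda>\<close> is below the stated bound. In case (i), \<open>\<kappa>\<^sub>p = 0\<close> and \<open>\<kappa>\<^sub>q\<close> is the lower bound on \<open>\<tau>\<close>; in case (ii),
  \<open>\<kappa>\<^sub>p = 1/(6 r)\<close> and \<open>\<kappa>\<^sub>q = 9 r/10\<close>.

  Nothing in the hypotheses asserts that a solution exists, so Fejer monotonicity with respect
  to solutions is not available as a starting point. Instead, strictness of \<open>\<alpha>\<^sub>R, \<alpha>\<^sub>F < 1\<close> improves
  both semimonotonicity constants of the shunted transistor by some \<open>\<epsilon> > 0\<close>
  (\<open>shunted_transistor_semimonotone\<close>). With this margin the map on differences is a strict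
  contraction (\<open>cp_step_contraction\<close>). Applied to consecutive iterates it makes the increments
  decay geometrically; the sequence converges, and closedness of the graphs identifies its limit
  as a solution.
\<close>

section \<open>Coercive quadratic forms\<close>

text \<open>
  A positive definite \<open>2 \<times> 2\<close> matrix dominates its determinant divided by its trace, a lower bound
  for the smaller eigenvalue. That value is rational in the entries and leaves the
  remainder \<open>|A x + B q|\<^sup>2 + |B x + C q|\<^sup>2\<close>, divided by the trace.
\<close>

lemma coercive_quadratic_form:
  fixes A B C :: real
  assumes "A > 0" and "A * C > B\<^sup>2"
  obtains \<eta> where "\<eta> > 0"
    and "\<And>x q :: 'a::real_inner.
      \<eta> * ((norm x)\<^sup>2 + (norm q)\<^sup>2) \<le> A * (norm x)\<^sup>2 + 2 * B * (x \<bullet> q) + C * (norm q)\<^sup>2"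
proof -
  have C: "C > 0"
  proof (rule ccontr)
    assume "\<not> C > 0"
    then have "A * C \<le> 0" using assms(1) by (simp add: mult_nonneg_nonpos)
    then show False using assms(2) zero_le_power2[of B] by linarith
  qed
  define \<eta> where "\<eta> = (A * C - B\<^sup>2) / (A + C)"
  have pos: "\<eta> > 0" unfolding \<eta>_def using assms C by simp
  have A\<eta>: "(A - \<eta>) * (A + C) = A\<^sup>2 + B\<^sup>2" and C\<eta>: "(C - \<eta>) * (A + C) = C\<^sup>2 + B\<^sup>2"
    unfolding \<eta>_def using assms(1) C by (simp_all add: field_simps power2_eq_square)
  have "\<eta> * ((norm x)\<^sup>2 + (norm q)\<^sup>2) \<le> A * (norm x)\<^sup>2 + 2 * B * (x \<bullet> q) + C * (norm q)\<^sup>2"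
    for x q :: 'a
  proof -
    have "(A * (norm x)\<^sup>2 + 2 * B * (x \<bullet> q) + C * (norm q)\<^sup>2 - \<eta> * ((norm x)\<^sup>2 + (norm q)\<^sup>2)) * (A + C)
        = ((A - \<eta>) * (A + C)) * (norm x)\<^sup>2 + 2 * B * (A + C) * (x \<bullet> q)
          + ((C - \<eta>) * (A + C)) * (norm q)\<^sup>2"
      by (simp add: algebra_simps)
    also have "\<dots> = (norm (A *\<^sub>R x + B *\<^sub>R q))\<^sup>2 + (norm (B *\<^sub>R x + C *\<^sub>R q))\<^sup>2"
      unfolding A\<eta> C\<eta> power2_norm_eq_inner
      by (simp add: inner_simps inner_commute algebra_simps power2_eq_square)
    also have "\<dots> \<ge> 0" by simp
    finally show ?thesis using assms(1) C by (simp add: zero_le_mult_iff)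
  qed
  then show ?thesis using pos that by blast
qed

section \<open>Semimonotonicity of the circuit elements\<close>

lemma semimonotoneD:
  assumes "semimonotone \<mu> \<rho> A" "u \<in> A x" "v \<in> A y"
  shows "\<mu> * (norm (x - y))\<^sup>2 + \<rho> * (norm (u - v))\<^sup>2 \<le> (x - y) \<bullet> (u - v)"
  using assms unfolding semimonotone_def gph_def by fastforce

lemma semimonotoneI:
  assumes "\<And>x u y v. u \<in> A x \<Longrightarrow> v \<in> A y \<Longrightarrow>
    \<mu> * (norm (x - y))\<^sup>2 + \<rho> * (norm (u - v))\<^sup>2 \<le> (x - y) \<bullet> (u - v)"
  shows "semimonotone \<mu> \<rho> A"
  using assms unfolding semimonotone_def gph_def by fastforce

lemma power2_norm_vec2: "(norm (x :: real^2))\<^sup>2 = (x $ 1)\<^sup>2 + (x $ 2)\<^sup>2"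
  unfolding power2_norm_eq_inner by (simp add: inner_vec_def sum_2 power2_eq_square)

lemma inner_vec2: "(x :: real^2) \<bullet> y = x $ 1 * y $ 1 + x $ 2 * y $ 2"
  by (simp add: inner_vec_def sum_2)

lemma semimonotone_prod_op:
  assumes "semimonotone \<mu> \<rho> A" "semimonotone \<mu> \<rho> B"
  shows "semimonotone \<mu> \<rho> (prod_op A B)"
proof (rule semimonotoneI)
  fix x u y v assume *: "u \<in> prod_op A B x" "v \<in> prod_op A B y"
  have "\<mu> * (x $ 1 - y $ 1)\<^sup>2 + \<rho> * (u $ 1 - v $ 1)\<^sup>2 \<le> (x $ 1 - y $ 1) * (u $ 1 - v $ 1)"
    using semimonotoneD[OF assms(1), of "u $ 1" "x $ 1" "v $ 1" "y $ 1"] *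
    by (simp add: prod_op_def)
  moreover have "\<mu> * (x $ 2 - y $ 2)\<^sup>2 + \<rho> * (u $ 2 - v $ 2)\<^sup>2 \<le> (x $ 2 - y $ 2) * (u $ 2 - v $ 2)"
    using semimonotoneD[OF assms(2), of "u $ 2" "x $ 2" "v $ 2" "y $ 2"] *
    by (simp add: prod_op_def)
  ultimately show "\<mu> * (norm (x - y))\<^sup>2 + \<rho> * (norm (u - v))\<^sup>2 \<le> (x - y) \<bullet> (u - v)"
    by (simp add: power2_norm_vec2 inner_vec2 distrib_left)
qed

lemma in_ebers_moll_iff:
  "w \<in> ebers_moll \<alpha>\<^sub>R \<alpha>\<^sub>F T v \<longleftrightarrow>
    (\<exists>u\<^sub>1 u\<^sub>2. u\<^sub>1 \<in> T (v $ 1) \<and> u\<^sub>2 \<in> T (v $ 2) \<and> w $ 1 = u\<^sub>1 - \<alpha>\<^sub>R * u\<^sub>2 \<and> w $ 2 = u\<^sub>2 - \<alpha>\<^sub>F * u\<^sub>1)"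
proof -
  have "w = (vector [vector [1, - \<alpha>\<^sub>R], vector [- \<alpha>\<^sub>F, 1]] :: real^2^2) *v vector [u\<^sub>1, u\<^sub>2]
      \<longleftrightarrow> w $ 1 = u\<^sub>1 - \<alpha>\<^sub>R * u\<^sub>2 \<and> w $ 2 = u\<^sub>2 - \<alpha>\<^sub>F * u\<^sub>1" for u\<^sub>1 u\<^sub>2
    by (simp add: vec_eq_iff forall_2 matrix_vector_mult_def sum_2 vector_2)
  then show ?thesis unfolding ebers_moll_def by auto
qed

text \<open>
  A port whose current increment \<open>b - \<alpha> b'\<close> opposes its voltage increment \<open>a\<close> is driven by the
  other junction: the diode increments \<open>b\<close> and \<open>b'\<close> then do not have opposite signs, and \<open>|b| < \<alpha> |b'|\<close>, so
  the current at the other port is larger by a factor of at least \<open>1/\<alpha>\<close>.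
\<close>

lemma opposed_current_dominated:
  fixes a b a' b' \<alpha> \<beta> :: real
  assumes "a * b \<ge> 0" "a' * b' \<ge> 0" "0 \<le> \<alpha>" "\<alpha> < 1" "0 \<le> \<beta>" "\<beta> < 1"
    and "a * (b - \<alpha> * b') < 0"
  shows "\<bar>b - \<alpha> * b'\<bar> \<le> \<alpha> * \<bar>b' - \<beta> * b\<bar>"
proof -
  have pos: "\<bar>b - \<alpha> * b'\<bar> \<le> \<alpha> * \<bar>b' - \<beta> * b\<bar>"
    if "a > 0" "b \<ge> 0" "b < \<alpha> * b'" for a b b' :: real
  proof -
    have "b' > 0" using that assms(3) by (smt (verit) mult_nonneg_nonpos)
    have "\<alpha> * \<beta> * b \<le> 1 * b"
      by (rule mult_right_mono) (use that assms in \<open>auto intro: mult_le_one\<close>)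
    then have "\<alpha> * b' - b \<le> \<alpha> * (b' - \<beta> * b)" by (simp add: algebra_simps)
    also have "\<dots> \<le> \<alpha> * \<bar>b' - \<beta> * b\<bar>" using assms(3) by (intro mult_left_mono) auto
    finally show ?thesis using that by linarith
  qed
  consider "a > 0" "b - \<alpha> * b' < 0" | "a < 0" "b - \<alpha> * b' > 0"
    using assms(7) by (auto simp: mult_less_0_iff)
  then show ?thesis
  proof cases
    case 1
    then have "b \<ge> 0" using assms(1) by (simp add: zero_le_mult_iff)
    then show ?thesis using pos[of a b b'] 1 by simp
  next
    case 2
    then have "b \<le> 0" using assms(1) by (simp add: zero_le_mult_iff)
    then show ?thesis using pos[of "-a" "-b" "-b'"] 2 by (simp add: abs_minus_commute)
  qed
qed

lemma young_inequality_scaled: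
  fixes a w m c \<theta> S :: real
  assumes "m > 0" "4 * m * c \<ge> \<theta>" "w\<^sup>2 \<le> \<theta> * S" "S \<ge> 0"
  shows "a * w \<ge> - m * a\<^sup>2 - c * S"
proof -
  have "w\<^sup>2 \<le> 4 * m * c * S"
    using assms(3) mult_right_mono[OF assms(2,4)] by linarith
  moreover have "0 \<le> (2 * m * a + w)\<^sup>2" by simp
  ultimately have "0 \<le> 4 * m * (m * a\<^sup>2 + a * w + c * S)"
    by (simp add: power2_eq_square algebra_simps)
  then show ?thesis using assms(1) by (simp add: zero_le_mult_iff)
qed

text \<open>
  At most one of the two ports can dissipate a negative amount, and its current carries at most
  the fraction \<open>\<theta> = \<alpha>\<^sup>2/(1 + \<alpha>\<^sup>2)\<close> of the squared norm of the current vector, where \<open>\<alpha>\<close> is the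
  larger transport factor. Young's inequality then trades voltages against currents freely along
  \<open>4 m c = \<theta>\<close>. The uniform constant would be \<open>1/2\<close>; the strict inequality \<open>\<theta> < 1/2\<close> is the
  margin from which the contraction originates.
\<close>

lemma ebers_moll_semimonotone:
  assumes "\<alpha>\<^sub>R \<in> {0..<1}" "\<alpha>\<^sub>F \<in> {0..<1}" "monotone_op T"
  obtains \<theta> where "0 \<le> \<theta>" "\<theta> < 1 / 2"
    and "\<And>m c. m > 0 \<Longrightarrow> 4 * m * c \<ge> \<theta> \<Longrightarrow> semimonotone (- m) (- c) (ebers_moll \<alpha>\<^sub>R \<alpha>\<^sub>F T)"
proof -
  define \<alpha> where "\<alpha> = max \<alpha>\<^sub>R \<alpha>\<^sub>F"
  define \<theta> where "\<theta> = \<alpha>\<^sup>2 / (1 + \<alpha>\<^sup>2)"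
  have \<alpha>: "0 \<le> \<alpha>" "\<alpha> < 1" "\<alpha>\<^sub>R \<le> \<alpha>" "\<alpha>\<^sub>F \<le> \<alpha>" using assms unfolding \<alpha>_def by auto
  have sq: "\<alpha>\<^sup>2 < 1" using \<alpha> by (simp add: power_less_one_iff abs_square_less_1)
  have den: "1 + \<alpha>\<^sup>2 > 0" by (simp add: add_pos_nonneg)
  have \<theta>: "0 \<le> \<theta>" "\<theta> < 1 / 2"
    unfolding \<theta>_def using sq den by (auto simp: field_simps)
  have share: "w\<^sup>2 \<le> \<theta> * (w\<^sup>2 + w'\<^sup>2)" if "\<bar>w\<bar> \<le> \<beta> * \<bar>w'\<bar>" "\<beta> \<le> \<alpha>" for w w' \<beta> :: real
  proof -
    have "\<bar>w\<bar> \<le> \<alpha> * \<bar>w'\<bar>" using that mult_right_mono[of \<beta> \<alpha> "\<bar>w'\<bar>"] by linarith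
    then have "\<bar>w\<bar>\<^sup>2 \<le> (\<alpha> * \<bar>w'\<bar>)\<^sup>2" by (rule power_mono) simp
    then have "w\<^sup>2 \<le> \<alpha>\<^sup>2 * w'\<^sup>2" by (simp add: power_mult_distrib)
    then show ?thesis unfolding \<theta>_def using den by (simp add: field_simps)
  qed
  have "semimonotone (- m) (- c) (ebers_moll \<alpha>\<^sub>R \<alpha>\<^sub>F T)" if m: "m > 0" and mc: "4 * m * c \<ge> \<theta>" for m c
  proof (rule semimonotoneI)
    fix x w y w'
    assume "w \<in> ebers_moll \<alpha>\<^sub>R \<alpha>\<^sub>F T x" "w' \<in> ebers_moll \<alpha>\<^sub>R \<alpha>\<^sub>F T y"
    then obtain u\<^sub>1 u\<^sub>2 u\<^sub>1' u\<^sub>2' where u: "u\<^sub>1 \<in> T (x $ 1)" "u\<^sub>2 \<in> T (x $ 2)" "u\<^sub>1' \<in> T (y $ 1)" "u\<^sub>2' \<in> T (y $ 2)"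
      and w: "w $ 1 = u\<^sub>1 - \<alpha>\<^sub>R * u\<^sub>2" "w $ 2 = u\<^sub>2 - \<alpha>\<^sub>F * u\<^sub>1"
        "w' $ 1 = u\<^sub>1' - \<alpha>\<^sub>R * u\<^sub>2'" "w' $ 2 = u\<^sub>2' - \<alpha>\<^sub>F * u\<^sub>1'"
      by (auto simp: in_ebers_moll_iff)
    define a\<^sub>1 a\<^sub>2 b\<^sub>1 b\<^sub>2 where ab: "a\<^sub>1 = x $ 1 - y $ 1" "a\<^sub>2 = x $ 2 - y $ 2" "b\<^sub>1 = u\<^sub>1 - u\<^sub>1'" "b\<^sub>2 = u\<^sub>2 - u\<^sub>2'"
    define w\<^sub>1 w\<^sub>2 where w12: "w\<^sub>1 = b\<^sub>1 - \<alpha>\<^sub>R * b\<^sub>2" "w\<^sub>2 = b\<^sub>2 - \<alpha>\<^sub>F * b\<^sub>1"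
    define S where "S = w\<^sub>1\<^sup>2 + w\<^sub>2\<^sup>2"
    have d: "w $ 1 - w' $ 1 = w\<^sub>1" "w $ 2 - w' $ 2 = w\<^sub>2"
      unfolding w w12 ab by (simp_all add: algebra_simps)
    have mono: "a\<^sub>1 * b\<^sub>1 \<ge> 0" "a\<^sub>2 * b\<^sub>2 \<ge> 0"
      using assms(3) u semimonotoneD[of 0 0 T] unfolding monotone_op_def ab by force+
    have S: "S \<ge> 0" unfolding S_def by simp
    have c: "c \<ge> 0" using m mc \<theta>(1) by (smt (verit) mult_pos_neg)
    have cS: "c * S \<ge> 0" using c S by simp
    have ma: "m * a\<^sub>1\<^sup>2 \<ge> 0" "m * a\<^sub>2\<^sup>2 \<ge> 0" using m by simp_all
    have one: "a\<^sub>1 * w\<^sub>1 \<ge> - m * a\<^sub>1\<^sup>2 - c * S \<and> \<bar>w\<^sub>1\<bar> \<le> \<alpha>\<^sub>R * \<bar>w\<^sub>2\<bar>" if "a\<^sub>1 * w\<^sub>1 < 0"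
    proof -
      have dom: "\<bar>w\<^sub>1\<bar> \<le> \<alpha>\<^sub>R * \<bar>w\<^sub>2\<bar>"
        using opposed_current_dominated[of a\<^sub>1 b\<^sub>1 a\<^sub>2 b\<^sub>2 \<alpha>\<^sub>R \<alpha>\<^sub>F] mono assms(1,2) that
        unfolding w12 by simp
      show ?thesis
        using young_inequality_scaled[OF m mc, of w\<^sub>1 S a\<^sub>1] share[OF dom \<alpha>(3)] S dom unfolding S_def by blast
    qed
    have two: "a\<^sub>2 * w\<^sub>2 \<ge> - m * a\<^sub>2\<^sup>2 - c * S \<and> \<bar>w\<^sub>2\<bar> \<le> \<alpha>\<^sub>F * \<bar>w\<^sub>1\<bar>" if "a\<^sub>2 * w\<^sub>2 < 0"
    proof -
      have dom: "\<bar>w\<^sub>2\<bar> \<le> \<alpha>\<^sub>F * \<bar>w\<^sub>1\<bar>"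
        using opposed_current_dominated[of a\<^sub>2 b\<^sub>2 a\<^sub>1 b\<^sub>1 \<alpha>\<^sub>F \<alpha>\<^sub>R] mono assms(1,2) that
        unfolding w12 by simp
      show ?thesis
        using young_inequality_scaled[OF m mc, of w\<^sub>2 S a\<^sub>2] share[OF dom \<alpha>(4)] S dom
        unfolding S_def by (simp add: add.commute)
    qed
    have notboth: False if "a\<^sub>1 * w\<^sub>1 < 0" "a\<^sub>2 * w\<^sub>2 < 0"
    proof -
      have "\<bar>w\<^sub>1\<bar> \<le> \<alpha>\<^sub>R * \<bar>w\<^sub>2\<bar>" "\<bar>w\<^sub>2\<bar> \<le> \<alpha>\<^sub>F * \<bar>w\<^sub>1\<bar>" using one two that by blast+
      moreover have "\<bar>w\<^sub>1\<bar> > 0" "\<bar>w\<^sub>2\<bar> > 0" using that by auto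
      ultimately show False
        using assms(1,2) mult_strict_right_mono[of \<alpha>\<^sub>R 1 "\<bar>w\<^sub>2\<bar>"] mult_strict_right_mono[of \<alpha>\<^sub>F 1 "\<bar>w\<^sub>1\<bar>"]
        unfolding atLeastLessThan_iff by linarith
    qed
    have "- m * (a\<^sub>1\<^sup>2 + a\<^sub>2\<^sup>2) - c * S \<le> a\<^sub>1 * w\<^sub>1 + a\<^sub>2 * w\<^sub>2"
    proof -
      have "- m * a\<^sub>1\<^sup>2 - c * S \<le> a\<^sub>1 * w\<^sub>1" "- m * a\<^sub>2\<^sup>2 - c * S \<le> a\<^sub>2 * w\<^sub>2"
        using one two ma cS by linarith+
      moreover have "a\<^sub>1 * w\<^sub>1 \<ge> 0 \<or> a\<^sub>2 * w\<^sub>2 \<ge> 0" using notboth by force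
      moreover have "- m * (a\<^sub>1\<^sup>2 + a\<^sub>2\<^sup>2) = - m * a\<^sub>1\<^sup>2 - m * a\<^sub>2\<^sup>2" by (simp add: algebra_simps)
      ultimately show ?thesis using ma by linarith
    qed
    then show "- m * (norm (x - y))\<^sup>2 + - c * (norm (w - w'))\<^sup>2 \<le> (x - y) \<bullet> (w - w')"
      by (simp add: power2_norm_vec2 inner_vec2 d S_def ab)
  qed
  then show ?thesis using \<theta> that by blast
qed

text \<open>
  Substituting \<open>g = w + a/r\<close> turns \<open>\<langle>a, g\<rangle> - \<mu> |a|\<^sup>2 + \<kappa> |g|\<^sup>2\<close> into
  \<open>N \<langle>a, w\<rangle> + M |a|\<^sup>2 + \<kappa> |w|\<^sup>2\<close> with \<open>N = 1 + 2 \<kappa>/r\<close> and \<open>M = 1/r + \<kappa>/r\<^sup>2 - \<mu>\<close>. The bound of the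
  transistor with \<open>4 m c = 1/2\<close> would make this nonnegative as soon as \<open>N\<^sup>2 \<le> 8 \<kappa> M\<close>; because
  \<open>\<theta> < 1/2\<close>, a fixed fraction of \<open>M |a|\<^sup>2 + \<kappa> |w|\<^sup>2\<close> is left over, and this gives the \<open>\<epsilon>\<close>.
\<close>

lemma shunted_transistor_semimonotone:
  assumes "\<alpha>\<^sub>R \<in> {0..<1}" "\<alpha>\<^sub>F \<in> {0..<1}" "monotone_op T" "r > 0"
    and "\<kappa> > 0" "(1 + 2 * \<kappa> / r)\<^sup>2 \<le> 8 * \<kappa> * (1 / r + \<kappa> / r\<^sup>2 - \<mu>)"
  obtains \<epsilon> where "\<epsilon> > 0"
    and "semimonotone (\<mu> + \<epsilon>) (- \<kappa> + \<epsilon>) (\<lambda>v. ebers_moll \<alpha>\<^sub>R \<alpha>\<^sub>F T v + {(1 / r) *\<^sub>R v})"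
proof -
  define N M where "N = 1 + 2 * \<kappa> / r" and "M = 1 / r + \<kappa> / r\<^sup>2 - \<mu>"
  have N: "N > 0" using assms(4,5) unfolding N_def by (simp add: add_pos_pos)
  have NM: "N\<^sup>2 \<le> 8 * \<kappa> * M" using assms(6) unfolding N_def M_def .
  have "8 * \<kappa> * M > 0" using NM N zero_less_power[OF N, of 2] by linarith
  then have M: "M > 0" using assms(5) by (simp add: zero_less_mult_iff)
  obtain \<theta> where \<theta>: "0 \<le> \<theta>" "\<theta> < 1 / 2"
    and T: "\<And>m c. m > 0 \<Longrightarrow> 4 * m * c \<ge> \<theta> \<Longrightarrow> semimonotone (- m) (- c) (ebers_moll \<alpha>\<^sub>R \<alpha>\<^sub>F T)"
    using ebers_moll_semimonotone[OF assms(1-3)] by blast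
  \<comment> \<open>Any \<open>s\<close> strictly between 0 and 1 with \<open>s\<^sup>2 \<ge> 2 \<theta>\<close> serves.\<close>
  define s where "s = sqrt ((2 * \<theta> + 1) / 2)"
  have s2: "s\<^sup>2 = (2 * \<theta> + 1) / 2" unfolding s_def using \<theta> by simp
  have s: "0 < s" "s < 1" unfolding s_def using \<theta> by simp_all
  have T': "semimonotone (- (M * s / N)) (- (\<kappa> * s / N)) (ebers_moll \<alpha>\<^sub>R \<alpha>\<^sub>F T)"
  proof (rule T)
    show "M * s / N > 0" using M N s by simp
    have "\<theta> \<le> s\<^sup>2 / 2" using s2 \<theta> by simp
    also have "\<dots> = (s\<^sup>2 / (2 * N\<^sup>2)) * N\<^sup>2" using N by simp
    also have "\<dots> \<le> (s\<^sup>2 / (2 * N\<^sup>2)) * (8 * \<kappa> * M)" using NM by (intro mult_left_mono) simp_all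
    also have "\<dots> = 4 * (M * s / N) * (\<kappa> * s / N)" by (simp add: power2_eq_square)
    finally show "\<theta> \<le> 4 * (M * s / N) * (\<kappa> * s / N)" .
  qed
  have "(M * (1 - s) + \<kappa> * (1 - s) / r\<^sup>2) * (\<kappa> * (1 - s)) > (- (\<kappa> * (1 - s) / r))\<^sup>2"
  proof -
    have "M * (1 - s) * (\<kappa> * (1 - s)) > 0" using M s assms(5) by simp
    moreover have "(M * (1 - s) + \<kappa> * (1 - s) / r\<^sup>2) * (\<kappa> * (1 - s)) - (- (\<kappa> * (1 - s) / r))\<^sup>2
        = M * (1 - s) * (\<kappa> * (1 - s))"
      by (simp add: distrib_right power_divide power_mult_distrib) (simp add: power2_eq_square)
    ultimately show ?thesis by linarith
  qed
  moreover have "M * (1 - s) + \<kappa> * (1 - s) / r\<^sup>2 > 0"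
    using M s assms(4,5) by (intro add_pos_nonneg) simp_all
  ultimately obtain \<epsilon> where \<epsilon>: "\<epsilon> > 0"
    and co: "\<And>x q :: real^2. \<epsilon> * ((norm x)\<^sup>2 + (norm q)\<^sup>2)
      \<le> (M * (1 - s) + \<kappa> * (1 - s) / r\<^sup>2) * (norm x)\<^sup>2 + 2 * (- (\<kappa> * (1 - s) / r)) * (x \<bullet> q)
        + \<kappa> * (1 - s) * (norm q)\<^sup>2"
    using coercive_quadratic_form by blast
  have "semimonotone (\<mu> + \<epsilon>) (- \<kappa> + \<epsilon>) (\<lambda>v. ebers_moll \<alpha>\<^sub>R \<alpha>\<^sub>F T v + {(1 / r) *\<^sub>R v})"
  proof (rule semimonotoneI)
    fix x u y u'
    assume "u \<in> ebers_moll \<alpha>\<^sub>R \<alpha>\<^sub>F T x + {(1 / r) *\<^sub>R x}" "u' \<in> ebers_moll \<alpha>\<^sub>R \<alpha>\<^sub>F T y + {(1 / r) *\<^sub>R y}"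
    then obtain w w' where w: "w \<in> ebers_moll \<alpha>\<^sub>R \<alpha>\<^sub>F T x" "w' \<in> ebers_moll \<alpha>\<^sub>R \<alpha>\<^sub>F T y"
      and u: "u = w + (1 / r) *\<^sub>R x" "u' = w' + (1 / r) *\<^sub>R y"
      by (auto simp: set_plus_def)
    define a g where "a = x - y" and "g = u - u'"
    have ww: "w - w' = g - (1 / r) *\<^sub>R a" unfolding u g_def a_def by (simp add: algebra_simps)
    define h where "h = g - (1 / r) *\<^sub>R a"
    have "- (M * s / N) * (norm a)\<^sup>2 + - (\<kappa> * s / N) * (norm h)\<^sup>2 \<le> a \<bullet> h"
      using semimonotoneD[OF T' w] unfolding ww a_def[symmetric] h_def .
    then have "N * (- (M * s / N) * (norm a)\<^sup>2 + - (\<kappa> * s / N) * (norm h)\<^sup>2) \<le> N * (a \<bullet> h)"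
      using N by (intro mult_left_mono) simp_all
    then have 1: "- M * s * (norm a)\<^sup>2 - \<kappa> * s * (norm h)\<^sup>2 \<le> N * (a \<bullet> h)"
      using N by (simp add: algebra_simps)
    have hh: "(norm h)\<^sup>2 = (norm g)\<^sup>2 - 2 / r * (a \<bullet> g) + (norm a)\<^sup>2 / r\<^sup>2"
      unfolding h_def power2_norm_eq_inner
      by (simp add: inner_simps inner_commute power2_eq_square algebra_simps)
    have ah: "a \<bullet> h = a \<bullet> g - (norm a)\<^sup>2 / r"
      unfolding h_def by (simp add: power2_norm_eq_inner inner_simps)
    have "a \<bullet> g - \<mu> * (norm a)\<^sup>2 + \<kappa> * (norm g)\<^sup>2 = N * (a \<bullet> h) + M * (norm a)\<^sup>2 + \<kappa> * (norm h)\<^sup>2"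
      unfolding hh ah N_def M_def using assms(4) by (simp add: field_simps power2_eq_square)
    also have "\<dots> \<ge> M * (1 - s) * (norm a)\<^sup>2 + \<kappa> * (1 - s) * (norm h)\<^sup>2"
      using 1 by (simp add: algebra_simps)
    also (xtrans) have "M * (1 - s) * (norm a)\<^sup>2 + \<kappa> * (1 - s) * (norm h)\<^sup>2
        = (M * (1 - s) + \<kappa> * (1 - s) / r\<^sup>2) * (norm a)\<^sup>2 + 2 * (- (\<kappa> * (1 - s) / r)) * (a \<bullet> g)
        + \<kappa> * (1 - s) * (norm g)\<^sup>2"
      unfolding hh by (simp add: algebra_simps)
    also (xtrans) note co[of a g]
    finally have "\<epsilon> * ((norm a)\<^sup>2 + (norm g)\<^sup>2) \<le> a \<bullet> g - \<mu> * (norm a)\<^sup>2 + \<kappa> * (norm g)\<^sup>2" .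
    then show "(\<mu> + \<epsilon>) * (norm (x - y))\<^sup>2 + (- \<kappa> + \<epsilon>) * (norm (u - u'))\<^sup>2 \<le> (x - y) \<bullet> (u - u')"
      unfolding a_def g_def by (simp add: algebra_simps)
  qed
  then show ?thesis using \<epsilon> that by blast
qed

section \<open>Closedness of the graphs\<close>

lemma closed_gph_prod_op:
  assumes "closed (gph A)" "closed (gph B)"
  shows "closed (gph (prod_op A B))"
proof -
  have "gph (prod_op A B) = (\<lambda>z. (fst z $ 1, snd z $ 1)) -` gph A \<inter> (\<lambda>z. (fst z $ 2, snd z $ 2)) -` gph B"
    by (auto simp: gph_def prod_op_def)
  then show ?thesis
    using assms by (auto intro!: closed_Int closed_vimage continuous_intros)
qed

text \<open>
  For \<open>\<alpha>\<^sub>R \<alpha>\<^sub>F \<noteq> 1\<close> the diode currents are continuous functions of the terminal currents, so the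
  graph is an intersection of continuous preimages of the diode graph.
\<close>

lemma closed_gph_ebers_moll:
  assumes "\<alpha>\<^sub>R * \<alpha>\<^sub>F \<noteq> 1" "closed (gph T)"
  shows "closed (gph (ebers_moll \<alpha>\<^sub>R \<alpha>\<^sub>F T))"
proof -
  define d where "d = 1 - \<alpha>\<^sub>R * \<alpha>\<^sub>F"
  have d: "d \<noteq> 0" using assms(1) unfolding d_def by simp
  have "w \<in> ebers_moll \<alpha>\<^sub>R \<alpha>\<^sub>F T v \<longleftrightarrow>
      (w $ 1 + \<alpha>\<^sub>R * w $ 2) / d \<in> T (v $ 1) \<and> (w $ 2 + \<alpha>\<^sub>F * w $ 1) / d \<in> T (v $ 2)" for w v
  proof -
    have "w $ 1 = u\<^sub>1 - \<alpha>\<^sub>R * u\<^sub>2 \<and> w $ 2 = u\<^sub>2 - \<alpha>\<^sub>F * u\<^sub>1 \<longleftrightarrow>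
        u\<^sub>1 = (w $ 1 + \<alpha>\<^sub>R * w $ 2) / d \<and> u\<^sub>2 = (w $ 2 + \<alpha>\<^sub>F * w $ 1) / d" for u\<^sub>1 u\<^sub>2
    proof -
      have iffs: "u\<^sub>1 = (w $ 1 + \<alpha>\<^sub>R * w $ 2) / d \<longleftrightarrow> u\<^sub>1 * d = w $ 1 + \<alpha>\<^sub>R * w $ 2"
        "u\<^sub>2 = (w $ 2 + \<alpha>\<^sub>F * w $ 1) / d \<longleftrightarrow> u\<^sub>2 * d = w $ 2 + \<alpha>\<^sub>F * w $ 1"
        using d by (auto simp: field_simps)
      have "w $ 1 = u\<^sub>1 - \<alpha>\<^sub>R * u\<^sub>2"
        if "u\<^sub>1 * d = w $ 1 + \<alpha>\<^sub>R * w $ 2" "u\<^sub>2 * d = w $ 2 + \<alpha>\<^sub>F * w $ 1"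
      proof -
        have "(u\<^sub>1 - \<alpha>\<^sub>R * u\<^sub>2) * d = w $ 1 * d"
          using that by (simp add: left_diff_distrib mult.assoc) (simp add: d_def algebra_simps)
        then show ?thesis using d by simp
      qed
      moreover have "w $ 2 = u\<^sub>2 - \<alpha>\<^sub>F * u\<^sub>1"
        if "u\<^sub>1 * d = w $ 1 + \<alpha>\<^sub>R * w $ 2" "u\<^sub>2 * d = w $ 2 + \<alpha>\<^sub>F * w $ 1"
      proof -
        have "(u\<^sub>2 - \<alpha>\<^sub>F * u\<^sub>1) * d = w $ 2 * d"
          using that by (simp add: left_diff_distrib mult.assoc) (simp add: d_def algebra_simps)
        then show ?thesis using d by simp
      qed
      moreover have "u\<^sub>1 * d = w $ 1 + \<alpha>\<^sub>R * w $ 2" "u\<^sub>2 * d = w $ 2 + \<alpha>\<^sub>F * w $ 1"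
        if "w $ 1 = u\<^sub>1 - \<alpha>\<^sub>R * u\<^sub>2" "w $ 2 = u\<^sub>2 - \<alpha>\<^sub>F * u\<^sub>1"
        unfolding that d_def by (simp_all add: algebra_simps)
      ultimately show ?thesis unfolding iffs by blast
    qed
    then show ?thesis unfolding in_ebers_moll_iff by auto
  qed
  then have "gph (ebers_moll \<alpha>\<^sub>R \<alpha>\<^sub>F T)
      = (\<lambda>z. (fst z $ 1, (snd z $ 1 + \<alpha>\<^sub>R * snd z $ 2) / d)) -` gph T
        \<inter> (\<lambda>z. (fst z $ 2, (snd z $ 2 + \<alpha>\<^sub>F * snd z $ 1) / d)) -` gph T"
    by (auto simp: gph_def)
  then show ?thesis
    using assms d by (auto intro!: closed_Int closed_vimage continuous_intros)
qed

lemma closed_gph_add_scaled_id: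
  fixes A :: "'a::real_normed_vector \<Rightarrow> 'a set"
  assumes "closed (gph A)"
  shows "closed (gph (\<lambda>v. A v + {c *\<^sub>R v}))"
proof -
  have "u \<in> A v + {c *\<^sub>R v} \<longleftrightarrow> u - c *\<^sub>R v \<in> A v" for u v
    by (force simp: set_plus_def)
  then have "gph (\<lambda>v. A v + {c *\<^sub>R v}) = (\<lambda>z. (fst z, snd z - c *\<^sub>R fst z)) -` gph A"
    by (auto simp: gph_def)
  then show ?thesis using assms by (auto intro!: closed_vimage continuous_intros)
qed

section \<open>Contraction of the iteration\<close>

text \<open>
  The squared norm induced by the preconditioner \<open>[[1/\<gamma>, -1], [-1, 1/\<tau>]]\<close>.
\<close>

definition cp_energy :: "real \<Rightarrow> real \<Rightarrow> 'a::real_inner \<Rightarrow> 'a \<Rightarrow> real" where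
  "cp_energy \<gamma> \<tau> a b = (norm a)\<^sup>2 / \<gamma> - 2 * (a \<bullet> b) + (norm b)\<^sup>2 / \<tau>"

lemma two_inner_le: "2 * \<bar>a \<bullet> b\<bar> \<le> (norm a)\<^sup>2 + (norm (b::'a::real_inner))\<^sup>2"
  using Cauchy_Schwarz_ineq2[of a b] sum_squares_bound[of "norm a" "norm b"] by linarith

lemma cp_energy_upper:
  assumes "\<gamma> > 0" "\<tau> > 0"
  shows "cp_energy \<gamma> \<tau> a b \<le> (1 / \<gamma> + 1 / \<tau> + 1) * ((norm a)\<^sup>2 + (norm b)\<^sup>2)"
proof -
  have "(norm b)\<^sup>2 / \<gamma> \<ge> 0" "(norm a)\<^sup>2 / \<tau> \<ge> 0" using assms by simp_all
  then show ?thesis using two_inner_le[of a b] unfolding cp_energy_def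
    by (simp add: algebra_simps)
qed

lemma cp_energy_lower:
  assumes "\<gamma> > 0" "\<tau> > 0" "\<gamma> * \<tau> < 1"
  obtains c where "c > 0"
    and "\<And>a b :: 'a::real_inner. c * ((norm a)\<^sup>2 + (norm b)\<^sup>2) \<le> cp_energy \<gamma> \<tau> a b"
proof -
  have "1 / \<gamma> > 0" "(1 / \<gamma>) * (1 / \<tau>) > (- 1)\<^sup>2" using assms by (simp_all add: field_simps)
  from coercive_quadratic_form[OF this] obtain c where "c > 0"
    and "\<And>a b :: 'a. c * ((norm a)\<^sup>2 + (norm b)\<^sup>2)
      \<le> 1 / \<gamma> * (norm a)\<^sup>2 + 2 * (- 1) * (a \<bullet> b) + 1 / \<tau> * (norm b)\<^sup>2" by metis
  then show ?thesis using that unfolding cp_energy_def by auto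
qed

lemma cp_energy_add_le:
  assumes "\<gamma> > 0" "\<tau> > 0" "\<gamma> * \<tau> < 1"
  shows "cp_energy \<gamma> \<tau> (a + a') (b + b' :: 'a::real_inner) \<le> 2 * cp_energy \<gamma> \<tau> a b + 2 * cp_energy \<gamma> \<tau> a' b'"
proof -
  obtain c where "c > 0"
    and "\<And>a b :: 'a. c * ((norm a)\<^sup>2 + (norm b)\<^sup>2) \<le> cp_energy \<gamma> \<tau> a b"
    using cp_energy_lower[OF assms] by blast
  then have "0 \<le> cp_energy \<gamma> \<tau> (a - a') (b - b')"
    by (smt (verit) mult_nonneg_nonneg zero_le_power2)
  also have "\<dots> = 2 * cp_energy \<gamma> \<tau> a b + 2 * cp_energy \<gamma> \<tau> a' b' - cp_energy \<gamma> \<tau> (a + a') (b + b')"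
    unfolding cp_energy_def
    by (simp add: power2_norm_eq_inner inner_simps inner_commute add_divide_distrib diff_divide_distrib)
  finally show ?thesis by simp
qed

text \<open>
  The energy in the dual variables \<open>(p, q) = P (a, b)\<close>: its matrix is \<open>P\<^sup>-\<^sup>1\<close>, cleared of the
  denominator \<open>1 - \<gamma> \<tau>\<close>. These are the variables in which the losses \<open>\<kappa>\<^sub>p\<close> and \<open>\<kappa>\<^sub>q\<close> are diagonal.
\<close>

lemma cp_energy_dual:
  assumes "\<gamma> > 0" "\<tau> > 0" "\<gamma> * \<tau> < 1"
  defines "p \<equiv> \<lambda>a b :: 'a::real_inner. a /\<^sub>R \<gamma> - b" and "q \<equiv> \<lambda>a b. b /\<^sub>R \<tau> - a"
  shows "(1 - \<gamma> * \<tau>) * cp_energy \<gamma> \<tau> a b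
    = \<gamma> * (norm (p a b))\<^sup>2 + 2 * (\<gamma> * \<tau>) * (p a b \<bullet> q a b) + \<tau> * (norm (q a b))\<^sup>2"
  using assms(1,2) unfolding cp_energy_def p_def q_def power2_norm_eq_inner
  by (simp add: inner_simps inner_commute field_simps)

text \<open>
  This is \<open>|d - t e|\<^sup>2 = |d|\<^sup>2 - 2 t \<langle>d, e\<rangle> + t\<^sup>2 |e|\<^sup>2\<close> in the norm of \<open>P\<close> for \<open>d = (di, dv)\<close> and
  \<open>e = d - (x, y)\<close>, with \<open>\<langle>d, P e\<rangle>\<close> split into \<open>\<langle>(x, y), P e\<rangle> + \<langle>e, P e\<rangle>\<close>. The skew part of the
  primal-dual operator pairs to zero with \<open>(x, y)\<close>, which is why \<open>P e\<close> may be replaced by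
  the increments of \<open>R\<close> and \<open>G\<close>.
\<close>

lemma cp_energy_relaxed_step:
  fixes di dv x y :: "'a::real_inner"
  assumes "\<gamma> \<noteq> 0" "\<tau> \<noteq> 0"
  shows "cp_energy \<gamma> \<tau> (di + t *\<^sub>R (x - di)) (dv + t *\<^sub>R (y - dv))
    = cp_energy \<gamma> \<tau> di dv
      - 2 * t * (x \<bullet> ((di - x) /\<^sub>R \<gamma> - dv) + y \<bullet> ((dv - y) /\<^sub>R \<tau> + 2 *\<^sub>R x - di)
                 + (1 - t / 2) * cp_energy \<gamma> \<tau> (di - x) (dv - y))"
  using assms unfolding cp_energy_def power2_norm_eq_inner
  by (simp add: inner_simps inner_commute field_simps)

text \<open>
  Here \<open>x, y\<close> are differences of resolvent values and \<open>f, g\<close> the corresponding differences in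
  \<open>R, G\<close>. With \<open>(p, q) = P e\<close> one has \<open>f = p - y\<close> and \<open>g = q + x\<close>, so the constant \<open>\<rho>\<^sub>R\<close>
  acts on \<open>y\<close> and the constant \<open>\<rho>\<^sub>G\<close> on \<open>x\<close>: this is the crosswise compensation in the hypotheses
  \<open>dual\<close> and \<open>primal\<close>. The last two hypotheses say that
  \<open>(1 - t/2) P\<^sup>-\<^sup>1 - diag(\<kappa>\<^sub>p, \<kappa>\<^sub>q)\<close>, multiplied by \<open>1 - \<gamma> \<tau>\<close>, is positive definite. The dissipation
  is then coercive in \<open>(x, y, p, q)\<close>, which controls \<open>d = (x, y) + P\<^sup>-\<^sup>1 (p, q)\<close>.
\<close>

lemma cp_step_contraction:
  fixes \<gamma> \<tau> t :: real
  assumes "\<gamma> > 0" "\<tau> > 0" "\<gamma> * \<tau> < 1" "t > 0"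
    and "\<epsilon> > 0"
    and dual: "\<And>y p :: 'a::real_inner.
      \<epsilon> * (norm y)\<^sup>2 - \<kappa>\<^sub>p * (norm p)\<^sup>2 \<le> \<mu>\<^sub>G * (norm y)\<^sup>2 + \<rho>\<^sub>R * (norm (p - y))\<^sup>2"
    and primal: "\<And>x q :: 'a.
      \<epsilon> * (norm x)\<^sup>2 - \<kappa>\<^sub>q * (norm q)\<^sup>2 \<le> \<mu>\<^sub>R * (norm x)\<^sup>2 + \<rho>\<^sub>G * (norm (q + x))\<^sup>2"
    and "\<kappa>\<^sub>p * (1 - \<gamma> * \<tau>) < (1 - t / 2) * \<gamma>"
    and "((1 - t / 2) * \<gamma> * \<tau>)\<^sup>2
      < ((1 - t / 2) * \<gamma> - \<kappa>\<^sub>p * (1 - \<gamma> * \<tau>)) * ((1 - t / 2) * \<tau> - \<kappa>\<^sub>q * (1 - \<gamma> * \<tau>))"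
  obtains \<delta> where "\<delta> > 0"
    and "\<And>di dv x y f g :: 'a.
      f = (di - x) /\<^sub>R \<gamma> - dv \<Longrightarrow> g = (dv - y) /\<^sub>R \<tau> + 2 *\<^sub>R x - di \<Longrightarrow>
      \<mu>\<^sub>R * (norm x)\<^sup>2 + \<rho>\<^sub>R * (norm f)\<^sup>2 \<le> x \<bullet> f \<Longrightarrow> \<mu>\<^sub>G * (norm y)\<^sup>2 + \<rho>\<^sub>G * (norm g)\<^sup>2 \<le> y \<bullet> g \<Longrightarrow>
      cp_energy \<gamma> \<tau> (di + t *\<^sub>R (x - di)) (dv + t *\<^sub>R (y - dv)) \<le> (1 - \<delta>) * cp_energy \<gamma> \<tau> di dv"
proof -
  define l where "l = 1 - t / 2"
  define D where "D = 1 - \<gamma> * \<tau>"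
  have D: "D > 0" using assms(3) unfolding D_def by simp
  obtain \<eta> where \<eta>: "\<eta> > 0"
    and co: "\<And>p q :: 'a. \<eta> * ((norm p)\<^sup>2 + (norm q)\<^sup>2)
      \<le> (l * \<gamma> - \<kappa>\<^sub>p * D) * (norm p)\<^sup>2 + 2 * (l * \<gamma> * \<tau>) * (p \<bullet> q) + (l * \<tau> - \<kappa>\<^sub>q * D) * (norm q)\<^sup>2"
    using coercive_quadratic_form[of "l * \<gamma> - \<kappa>\<^sub>p * D" "l * \<gamma> * \<tau>" "l * \<tau> - \<kappa>\<^sub>q * D"] assms(8,9)
    unfolding l_def D_def by auto
  define c where "c = min \<epsilon> (\<eta> / D)"
  have c: "c > 0" "c \<le> \<epsilon>" "c \<le> \<eta> / D" unfolding c_def using \<eta> D assms(5) by auto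
  define C\<^sub>1 C\<^sub>2 where "C\<^sub>1 = 1 / \<gamma> + 1 / \<tau> + 1" and "C\<^sub>2 = (\<gamma> + \<tau> + \<gamma> * \<tau>) / D"
  have C: "C\<^sub>1 > 0" "C\<^sub>2 > 0" unfolding C\<^sub>1_def C\<^sub>2_def using assms D by (simp_all add: add_pos_pos)
  define K where "K = 2 * (C\<^sub>1 + C\<^sub>2)"
  have K: "K > 0" unfolding K_def using C by simp
  define \<delta> where "\<delta> = 2 * t * c / K"
  have \<delta>: "\<delta> > 0" unfolding \<delta>_def using assms(4) c K by simp
  have "cp_energy \<gamma> \<tau> (di + t *\<^sub>R (x - di)) (dv + t *\<^sub>R (y - dv)) \<le> (1 - \<delta>) * cp_energy \<gamma> \<tau> di dv"
    if f: "f = (di - x) /\<^sub>R \<gamma> - dv" and g: "g = (dv - y) /\<^sub>R \<tau> + 2 *\<^sub>R x - di"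
      and R: "\<mu>\<^sub>R * (norm x)\<^sup>2 + \<rho>\<^sub>R * (norm f)\<^sup>2 \<le> x \<bullet> f"
      and G: "\<mu>\<^sub>G * (norm y)\<^sup>2 + \<rho>\<^sub>G * (norm g)\<^sup>2 \<le> y \<bullet> g" for di dv x y f g :: 'a
  proof -
    define a b where "a = di - x" and "b = dv - y"
    define p q where "p = a /\<^sub>R \<gamma> - b" and "q = b /\<^sub>R \<tau> - a"
    define S where "S = (norm x)\<^sup>2 + (norm y)\<^sup>2 + ((norm p)\<^sup>2 + (norm q)\<^sup>2)"
    have fp: "f = p - y" unfolding f p_def a_def b_def by (simp add: algebra_simps)
    have gq: "g = q + x" unfolding g q_def a_def b_def by (simp add: algebra_simps scaleR_2)
    have E: "D * cp_energy \<gamma> \<tau> a b = \<gamma> * (norm p)\<^sup>2 + 2 * (\<gamma> * \<tau>) * (p \<bullet> q) + \<tau> * (norm q)\<^sup>2"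
      unfolding D_def p_def q_def using cp_energy_dual[OF assms(1-3)] .
    have "\<eta> * ((norm p)\<^sup>2 + (norm q)\<^sup>2)
        \<le> l * (D * cp_energy \<gamma> \<tau> a b) - D * (\<kappa>\<^sub>p * (norm p)\<^sup>2 + \<kappa>\<^sub>q * (norm q)\<^sup>2)"
      using co[of p q] unfolding E by (simp add: algebra_simps)
    then have 1: "\<eta> / D * ((norm p)\<^sup>2 + (norm q)\<^sup>2)
        \<le> l * cp_energy \<gamma> \<tau> a b - (\<kappa>\<^sub>p * (norm p)\<^sup>2 + \<kappa>\<^sub>q * (norm q)\<^sup>2)"
      using D by (simp add: field_simps)
    have "c * S \<le> \<epsilon> * (norm x)\<^sup>2 + \<epsilon> * (norm y)\<^sup>2 + \<eta> / D * ((norm p)\<^sup>2 + (norm q)\<^sup>2)"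
    proof -
      have "c * ((norm p)\<^sup>2 + (norm q)\<^sup>2) \<le> \<eta> / D * ((norm p)\<^sup>2 + (norm q)\<^sup>2)"
        using c(3) by (intro mult_right_mono) simp_all
      moreover have "c * (norm x)\<^sup>2 \<le> \<epsilon> * (norm x)\<^sup>2" "c * (norm y)\<^sup>2 \<le> \<epsilon> * (norm y)\<^sup>2"
        using c(2) by (simp_all add: mult_right_mono)
      ultimately show ?thesis unfolding S_def distrib_left[of c] by linarith
    qed
    also have "\<dots> \<le> x \<bullet> f + y \<bullet> g + l * cp_energy \<gamma> \<tau> a b"
      using 1 R G dual[of y p] primal[of x q] unfolding fp gq by linarith
    finally have drop: "c * S \<le> x \<bullet> f + y \<bullet> g + l * cp_energy \<gamma> \<tau> a b" .
    have "D * cp_energy \<gamma> \<tau> a b \<le> (\<gamma> + \<tau> + \<gamma> * \<tau>) * ((norm p)\<^sup>2 + (norm q)\<^sup>2)"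
    proof -
      have "(\<gamma> * \<tau>) * (2 * (p \<bullet> q)) \<le> (\<gamma> * \<tau>) * ((norm p)\<^sup>2 + (norm q)\<^sup>2)"
        using two_inner_le[of p q] assms(1,2) by (intro mult_left_mono) auto
      moreover have "\<gamma> * (norm q)\<^sup>2 \<ge> 0" "\<tau> * (norm p)\<^sup>2 \<ge> 0" using assms(1,2) by simp_all
      ultimately show ?thesis unfolding E by (simp add: algebra_simps)
    qed
    then have e2: "cp_energy \<gamma> \<tau> a b \<le> C\<^sub>2 * ((norm p)\<^sup>2 + (norm q)\<^sup>2)"
      unfolding C\<^sub>2_def using D by (simp add: field_simps)
    have "cp_energy \<gamma> \<tau> di dv \<le> 2 * cp_energy \<gamma> \<tau> x y + 2 * cp_energy \<gamma> \<tau> a b"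
      using cp_energy_add_le[OF assms(1-3), of x a y b] unfolding a_def b_def by simp
    also have "\<dots> \<le> 2 * (C\<^sub>1 * ((norm x)\<^sup>2 + (norm y)\<^sup>2)) + 2 * (C\<^sub>2 * ((norm p)\<^sup>2 + (norm q)\<^sup>2))"
      using cp_energy_upper[OF assms(1,2), of x y] e2 unfolding C\<^sub>1_def by linarith
    also have "\<dots> \<le> K * S"
    proof -
      have "C\<^sub>1 * ((norm p)\<^sup>2 + (norm q)\<^sup>2) \<ge> 0" "C\<^sub>2 * ((norm x)\<^sup>2 + (norm y)\<^sup>2) \<ge> 0" using C by simp_all
      then show ?thesis unfolding K_def S_def by (simp add: algebra_simps)
    qed
    finally have "\<delta> * cp_energy \<gamma> \<tau> di dv \<le> \<delta> * (K * S)" using \<delta> by (intro mult_left_mono) simp_all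
    also have "\<dots> = 2 * t * (c * S)" unfolding \<delta>_def using K by simp
    also have "\<dots> \<le> 2 * t * (x \<bullet> f + y \<bullet> g + l * cp_energy \<gamma> \<tau> a b)"
      using drop assms(4) by (intro mult_left_mono) simp_all
    finally have "\<delta> * cp_energy \<gamma> \<tau> di dv \<le> 2 * t * (x \<bullet> f + y \<bullet> g + l * cp_energy \<gamma> \<tau> a b)" .
    then show ?thesis
      using cp_energy_relaxed_step[of \<gamma> \<tau> di t x dv y] assms(1,2)
      unfolding f g a_def b_def l_def by (simp add: left_diff_distrib)
  qed
  then show ?thesis using \<delta> that by blast
qed

lemma convergent_of_geometric_increments:
  fixes z :: "nat \<Rightarrow> 'a::banach"
  assumes "c > 0" "\<And>k. c * (norm (z (Suc k) - z k))\<^sup>2 \<le> E k"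
    and "\<delta> > 0" "\<And>k. E (Suc k) \<le> (1 - \<delta>) * E k"
  shows "convergent z"
proof -
  \<comment> \<open>Truncated at 0 because \<open>\<delta> > 1\<close> is possible when all increments vanish.\<close>
  define \<theta> where "\<theta> = max 0 (1 - \<delta>)"
  have \<theta>: "0 \<le> \<theta>" "\<theta> < 1" unfolding \<theta>_def using assms(3) by auto
  have E0: "E k \<ge> 0" for k
    using assms(1) assms(2)[of k] by (smt (verit) mult_nonneg_nonneg zero_le_power2)
  have E: "E k \<le> \<theta> ^ k * E 0" for k
  proof (induction k)
    case (Suc k)
    have "E (Suc k) \<le> \<theta> * E k"
      using assms(4)[of k] mult_right_mono[OF _ E0, of "1 - \<delta>" \<theta> k] unfolding \<theta>_def by force
    also have "\<dots> \<le> \<theta> * (\<theta> ^ k * E 0)" using Suc \<theta> by (intro mult_left_mono)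
    finally show ?case by simp
  qed simp
  have bound: "norm (z (Suc k) - z k) \<le> sqrt (E 0 / c) * sqrt \<theta> ^ k" for k
  proof -
    have "c * (norm (z (Suc k) - z k))\<^sup>2 \<le> \<theta> ^ k * E 0" using assms(2)[of k] E[of k] by linarith
    then have "(norm (z (Suc k) - z k))\<^sup>2 \<le> E 0 / c * \<theta> ^ k" using assms(1) by (simp add: field_simps)
    then have "norm (z (Suc k) - z k) \<le> sqrt (E 0 / c * \<theta> ^ k)" by (rule real_le_rsqrt)
    then show ?thesis by (simp only: real_sqrt_mult real_sqrt_power)
  qed
  have "summable (\<lambda>k. sqrt (E 0 / c) * sqrt \<theta> ^ k)"
    using \<theta> by (intro summable_mult summable_geometric) simp
  then have "summable (\<lambda>k. z (Suc k) - z k)"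
    by (rule summable_comparison_test') (rule bound)
  then have "convergent (\<lambda>n. \<Sum>k<n. z (Suc k) - z k)" by (simp add: summable_iff_convergent)
  then have "convergent (\<lambda>n. z n - z 0)" by (simp add: sum_lessThan_telescope)
  then show ?thesis by (simp add: convergent_diff_const_right_iff)
qed

section \<open>Convergence of the Chambolle--Pock sequence\<close>

lemma resolvent_shift_iff:
  assumes "\<gamma> \<noteq> 0"
  shows "p \<in> resolvent \<gamma> (\<lambda>x. A x + {s}) x \<longleftrightarrow> (x - p) /\<^sub>R \<gamma> - s \<in> A p"
proof -
  have "x = p + \<gamma> *\<^sub>R (u + s) \<longleftrightarrow> u = (x - p) /\<^sub>R \<gamma> - s" for u
  proof
    assume "u = (x - p) /\<^sub>R \<gamma> - s"
    then have "\<gamma> *\<^sub>R (u + s) = x - p" using assms by simp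
    then show "x = p + \<gamma> *\<^sub>R (u + s)" by simp
  qed (use assms in simp)
  moreover have "p \<in> resolvent \<gamma> (\<lambda>x. A x + {s}) x \<longleftrightarrow> (\<exists>u\<in>A p. x = p + \<gamma> *\<^sub>R (u + s))"
    unfolding resolvent_def set_plus_def by blast
  ultimately show ?thesis by simp
qed

lemma primal_dual_solution_identity_iff:
  "primal_dual_solution R G (mat 1) s\<^sub>v s\<^sub>i (i, v) \<longleftrightarrow> - v - s\<^sub>v \<in> R i \<and> i - s\<^sub>i \<in> G v"
proof -
  have "(0, 0) = (f, g) + (v, - i) + (s\<^sub>v, s\<^sub>i) \<longleftrightarrow> f = - v - s\<^sub>v \<and> g = i - s\<^sub>i" for f g
    using eq_neg_iff_add_eq_0[of f "v + s\<^sub>v"] eq_neg_iff_add_eq_0[of g "- i + s\<^sub>i"]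
    by (auto simp: add.assoc diff_add_eq)
  moreover have "primal_dual_solution R G (mat 1) s\<^sub>v s\<^sub>i (i, v) \<longleftrightarrow>
      (\<exists>f\<in>R i. \<exists>g\<in>G v. (0, 0) = (f, g) + (v, - i) + (s\<^sub>v, s\<^sub>i))"
    unfolding primal_dual_solution_def primal_dual_op_def set_plus_def zero_prod_def
    by (auto simp: transpose_mat)
  ultimately show ?thesis by simp
qed

text \<open>
  The contraction is applied to consecutive iterates, since no fixed point is known beforehand.
  The residuals are increments of the iterates divided by the relaxation parameter, so they vanish
  along the convergent sequence, and the inclusions that define the resolvents pass to the limit.
\<close>

theorem chambolle_pock_converges:
  fixes R G :: "real^'n \<Rightarrow> (real^'n) set"
  assumes "\<gamma> > 0" "\<tau> > 0" "\<gamma> * \<tau> < 1" "t > 0"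
    and R: "semimonotone \<mu>\<^sub>R \<rho>\<^sub>R R" "closed (gph R)"
    and G: "semimonotone \<mu>\<^sub>G \<rho>\<^sub>G G" "closed (gph G)"
    and "\<epsilon> > 0"
    and dual: "\<And>y p :: real^'n.
      \<epsilon> * (norm y)\<^sup>2 - \<kappa>\<^sub>p * (norm p)\<^sup>2 \<le> \<mu>\<^sub>G * (norm y)\<^sup>2 + \<rho>\<^sub>R * (norm (p - y))\<^sup>2"
    and primal: "\<And>x q :: real^'n.
      \<epsilon> * (norm x)\<^sup>2 - \<kappa>\<^sub>q * (norm q)\<^sup>2 \<le> \<mu>\<^sub>R * (norm x)\<^sup>2 + \<rho>\<^sub>G * (norm (q + x))\<^sup>2"
    and "\<kappa>\<^sub>p * (1 - \<gamma> * \<tau>) < (1 - t / 2) * \<gamma>"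
    and "((1 - t / 2) * \<gamma> * \<tau>)\<^sup>2
      < ((1 - t / 2) * \<gamma> - \<kappa>\<^sub>p * (1 - \<gamma> * \<tau>)) * ((1 - t / 2) * \<tau> - \<kappa>\<^sub>q * (1 - \<gamma> * \<tau>))"
    and cp: "chambolle_pock R G (mat 1) s\<^sub>v s\<^sub>i \<gamma> \<tau> t i v"
  shows "\<exists>z. primal_dual_solution R G (mat 1) s\<^sub>v s\<^sub>i z \<and> (\<lambda>k. (i k, v k)) \<longlonglongrightarrow> z"
proof -
  have nz: "\<gamma> \<noteq> 0" "\<tau> \<noteq> 0" using assms(1,2) by auto
  have "\<forall>k. \<exists>ib vb.
        (i k - \<gamma> *\<^sub>R v k - ib) /\<^sub>R \<gamma> - s\<^sub>v \<in> R ib \<and>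
        (v k + \<tau> *\<^sub>R (2 *\<^sub>R ib - i k) - vb) /\<^sub>R \<tau> - s\<^sub>i \<in> G vb \<and>
        i (Suc k) = i k + t *\<^sub>R (ib - i k) \<and> v (Suc k) = v k + t *\<^sub>R (vb - v k)"
    using cp unfolding chambolle_pock_def resolvent_shift_iff[OF nz(1)] resolvent_shift_iff[OF nz(2)]
    by (simp add: transpose_mat)
  then obtain ib vb where
    "\<And>k. (i k - \<gamma> *\<^sub>R v k - ib k) /\<^sub>R \<gamma> - s\<^sub>v \<in> R (ib k)"
    "\<And>k. (v k + \<tau> *\<^sub>R (2 *\<^sub>R ib k - i k) - vb k) /\<^sub>R \<tau> - s\<^sub>i \<in> G (vb k)"
    and next_i: "\<And>k. i (Suc k) = i k + t *\<^sub>R (ib k - i k)"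
    and next_v: "\<And>k. v (Suc k) = v k + t *\<^sub>R (vb k - v k)"
    by metis
  moreover have "(i k - \<gamma> *\<^sub>R v k - ib k) /\<^sub>R \<gamma> - s\<^sub>v = (i k - ib k) /\<^sub>R \<gamma> - v k - s\<^sub>v"
    "(v k + \<tau> *\<^sub>R (2 *\<^sub>R ib k - i k) - vb k) /\<^sub>R \<tau> - s\<^sub>i = (v k - vb k) /\<^sub>R \<tau> + 2 *\<^sub>R ib k - i k - s\<^sub>i" for k
    using nz by (simp_all add: algebra_simps)
  ultimately have inR: "\<And>k. (i k - ib k) /\<^sub>R \<gamma> - v k - s\<^sub>v \<in> R (ib k)"
    and inG: "\<And>k. (v k - vb k) /\<^sub>R \<tau> + 2 *\<^sub>R ib k - i k - s\<^sub>i \<in> G (vb k)"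
    by simp_all
  obtain \<delta> where \<delta>: "\<delta> > 0"
    and step: "\<And>di dv x y f g :: real^'n.
      f = (di - x) /\<^sub>R \<gamma> - dv \<Longrightarrow> g = (dv - y) /\<^sub>R \<tau> + 2 *\<^sub>R x - di \<Longrightarrow>
      \<mu>\<^sub>R * (norm x)\<^sup>2 + \<rho>\<^sub>R * (norm f)\<^sup>2 \<le> x \<bullet> f \<Longrightarrow> \<mu>\<^sub>G * (norm y)\<^sup>2 + \<rho>\<^sub>G * (norm g)\<^sup>2 \<le> y \<bullet> g \<Longrightarrow>
      cp_energy \<gamma> \<tau> (di + t *\<^sub>R (x - di)) (dv + t *\<^sub>R (y - dv)) \<le> (1 - \<delta>) * cp_energy \<gamma> \<tau> di dv"
    using cp_step_contraction[OF assms(1-4) \<open>\<epsilon> > 0\<close> dual primal assms(12,13)] by blast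
  define E where "E k = cp_energy \<gamma> \<tau> (i (Suc k) - i k) (v (Suc k) - v k)" for k
  have rate: "E (Suc k) \<le> (1 - \<delta>) * E k" for k
  proof -
    have "E (Suc k) = cp_energy \<gamma> \<tau>
        ((i (Suc k) - i k) + t *\<^sub>R ((ib (Suc k) - ib k) - (i (Suc k) - i k)))
        ((v (Suc k) - v k) + t *\<^sub>R ((vb (Suc k) - vb k) - (v (Suc k) - v k)))"
      unfolding E_def by (subst (1) next_i[of "Suc k"], subst (2) next_i[of k],
          subst (1) next_v[of "Suc k"], subst (2) next_v[of k]) (simp add: algebra_simps)
    also have "\<dots> \<le> (1 - \<delta>) * E k"
      unfolding E_def
    proof (rule step[OF refl refl])
      show "\<mu>\<^sub>R * (norm (ib (Suc k) - ib k))\<^sup>2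
          + \<rho>\<^sub>R * (norm ((i (Suc k) - i k - (ib (Suc k) - ib k)) /\<^sub>R \<gamma> - (v (Suc k) - v k)))\<^sup>2
        \<le> (ib (Suc k) - ib k) \<bullet> ((i (Suc k) - i k - (ib (Suc k) - ib k)) /\<^sub>R \<gamma> - (v (Suc k) - v k))"
        using semimonotoneD[OF R(1) inR[of "Suc k"] inR[of k]] by (simp add: algebra_simps)
      show "\<mu>\<^sub>G * (norm (vb (Suc k) - vb k))\<^sup>2
          + \<rho>\<^sub>G * (norm ((v (Suc k) - v k - (vb (Suc k) - vb k)) /\<^sub>R \<tau>
              + 2 *\<^sub>R (ib (Suc k) - ib k) - (i (Suc k) - i k)))\<^sup>2
        \<le> (vb (Suc k) - vb k) \<bullet> ((v (Suc k) - v k - (vb (Suc k) - vb k)) /\<^sub>R \<tau>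
              + 2 *\<^sub>R (ib (Suc k) - ib k) - (i (Suc k) - i k))"
        using semimonotoneD[OF G(1) inG[of "Suc k"] inG[of k]] by (simp add: algebra_simps)
    qed
    finally show ?thesis .
  qed
  obtain c where c: "c > 0"
    and low: "\<And>a b :: real^'n. c * ((norm a)\<^sup>2 + (norm b)\<^sup>2) \<le> cp_energy \<gamma> \<tau> a b"
    using cp_energy_lower[OF assms(1-3)] by blast
  define z where "z k = (i k, v k)" for k
  have "c * (norm (z (Suc k) - z k))\<^sup>2 \<le> E k" for k
    using low unfolding z_def E_def by (simp add: norm_Pair)
  then have "convergent z"
    using c rate \<delta> by (intro convergent_of_geometric_increments[of c z E \<delta>]) auto
  then obtain i\<^sub>0 v\<^sub>0 where lim: "z \<longlonglongrightarrow> (i\<^sub>0, v\<^sub>0)"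
    unfolding convergent_def by (metis surj_pair)
  have i: "i \<longlonglongrightarrow> i\<^sub>0" and v: "v \<longlonglongrightarrow> v\<^sub>0"
    using tendsto_fst[OF lim] tendsto_snd[OF lim] unfolding z_def by simp_all
  have "ib = (\<lambda>k. i k + (i (Suc k) - i k) /\<^sub>R t)" "vb = (\<lambda>k. v k + (v (Suc k) - v k) /\<^sub>R t)"
    using next_i next_v assms(4) by auto
  then have ib: "ib \<longlonglongrightarrow> i\<^sub>0" and vb: "vb \<longlonglongrightarrow> v\<^sub>0"
    using tendsto_add[OF i tendsto_scaleR[OF tendsto_const tendsto_diff[OF LIMSEQ_Suc[OF i] i], of "inverse t"]]
      tendsto_add[OF v tendsto_scaleR[OF tendsto_const tendsto_diff[OF LIMSEQ_Suc[OF v] v], of "inverse t"]]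
    by simp_all
  have "(\<lambda>k. (ib k, (i k - ib k) /\<^sub>R \<gamma> - v k - s\<^sub>v)) \<longlonglongrightarrow> (i\<^sub>0, (i\<^sub>0 - i\<^sub>0) /\<^sub>R \<gamma> - v\<^sub>0 - s\<^sub>v)"
    by (intro tendsto_intros i v ib vb)
  from closed_sequentially[OF R(2) _ this] have "(i\<^sub>0, (i\<^sub>0 - i\<^sub>0) /\<^sub>R \<gamma> - v\<^sub>0 - s\<^sub>v) \<in> gph R"
    using inR by (simp add: gph_def)
  moreover have "(\<lambda>k. (vb k, (v k - vb k) /\<^sub>R \<tau> + 2 *\<^sub>R ib k - i k - s\<^sub>i))
      \<longlonglongrightarrow> (v\<^sub>0, (v\<^sub>0 - v\<^sub>0) /\<^sub>R \<tau> + 2 *\<^sub>R i\<^sub>0 - i\<^sub>0 - s\<^sub>i)"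
    by (intro tendsto_intros i v ib vb)
  from closed_sequentially[OF G(2) _ this] have "(v\<^sub>0, (v\<^sub>0 - v\<^sub>0) /\<^sub>R \<tau> + 2 *\<^sub>R i\<^sub>0 - i\<^sub>0 - s\<^sub>i) \<in> gph G"
    using inG by (simp add: gph_def)
  ultimately have "primal_dual_solution R G (mat 1) s\<^sub>v s\<^sub>i (i\<^sub>0, v\<^sub>0)"
    by (simp add: primal_dual_solution_identity_iff gph_def scaleR_2)
  then show ?thesis using lim unfolding z_def by blast
qed

section \<open>The common-emitter amplifier\<close>

theorem proposition10:
  fixes \<alpha>\<^sub>R \<alpha>\<^sub>F r v_in v_plus \<gamma> \<tau> relax :: real
    and T\<^sub>D R\<^sub>C R\<^sub>E :: "real \<Rightarrow> real set"
    and R G :: "real^2 \<Rightarrow> (real^2) set"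
    and L :: "real^2^2"
    and s\<^sub>v s\<^sub>i :: "real^2"
    and i v :: "nat \<Rightarrow> real^2"
  assumes "\<alpha>\<^sub>R \<in> {0..<1}" and "\<alpha>\<^sub>F \<in> {0..<1}"
    and "monotone_op T\<^sub>D" and "outer_semicontinuous T\<^sub>D"
    and "r > 0" and "v_plus > 0"
    and "outer_semicontinuous R\<^sub>C" and "outer_semicontinuous R\<^sub>E"
    and R_def: "R = prod_op R\<^sub>C R\<^sub>E"
    and G_def: "G = (\<lambda>v. ebers_moll \<alpha>\<^sub>R \<alpha>\<^sub>F T\<^sub>D v + {(1 / r) *\<^sub>R v})"
    and L_def: "L = mat 1"
    and s\<^sub>v_def: "s\<^sub>v = vector [v_plus - v_in, - v_in]"
    and s\<^sub>i_def: "s\<^sub>i = 0"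
    and cases:
      "(\<exists>\<sigma>. \<sigma> > r * (sqrt 2 - 1) / 2 \<and>
            strongly_monotone_op \<sigma> R\<^sub>C \<and> strongly_monotone_op \<sigma> R\<^sub>E \<and>
            (let \<tau>_low = - (\<sigma> * r * (1 - sqrt 2)) / (r * (1 - sqrt 2) + 2 * \<sigma>) in
               \<gamma> \<in> {0<..<1 / \<tau>_low} \<and>
               \<tau> \<in> {\<tau>_low<..<1 / \<gamma>} \<and>
               relax \<in> {0<..<2 * (1 - \<tau>_low / \<tau>)}))
       \<or>
       (semimonotone (9 / 8 * r) (- (1 / (8 * r))) R\<^sub>C \<and>
        semimonotone (9 / 8 * r) (- (1 / (8 * r))) R\<^sub>E \<and>
        \<gamma> \<in> {(5 - sqrt 10) / (9 * r)<..<(5 + sqrt 10) / (9 * r)} \<and>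
        \<tau> \<in> {9 * r * (6 * r * \<gamma> - 1) / (51 * r * \<gamma> - 10)<..<1 / \<gamma>} \<and>
        (let \<Delta> = - (1 / (12 * r * \<gamma>)) - 9 * r / (20 * \<tau>) in
           relax \<in> {0<..<2 * (1 + \<Delta> - sqrt (\<Delta>\<^sup>2 - 3 / (20 * \<gamma> * \<tau>) * (1 - \<gamma> * \<tau>)))}))"
    and "chambolle_pock R G L s\<^sub>v s\<^sub>i \<gamma> \<tau> relax i v"
  shows "\<exists>z. primal_dual_solution R G L s\<^sub>v s\<^sub>i z \<and> (\<lambda>k. (i k, v k)) \<longlonglongrightarrow> z"
proof -
  have T: "closed (gph T\<^sub>D)" using assms(4) unfolding outer_semicontinuous_def .
  have Rcl: "closed (gph R)"
    unfolding R_def using assms(7,8) unfolding outer_semicontinuous_def by (rule closed_gph_prod_op)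
  have "\<alpha>\<^sub>R * \<alpha>\<^sub>F < 1 * 1" using assms(1,2) by (intro mult_strict_mono') auto
  then have Gcl: "closed (gph G)"
    unfolding G_def by (intro closed_gph_add_scaled_id closed_gph_ebers_moll T) simp
  have cp: "chambolle_pock R G (mat 1) s\<^sub>v s\<^sub>i \<gamma> \<tau> relax i v" using assms(15) unfolding L_def .
  have r: "r > 0" by fact
  from cases show ?thesis
    unfolding L_def
  proof
    assume "\<exists>\<sigma>. \<sigma> > r * (sqrt 2 - 1) / 2 \<and>
            strongly_monotone_op \<sigma> R\<^sub>C \<and> strongly_monotone_op \<sigma> R\<^sub>E \<and>
            (let \<tau>_low = - (\<sigma> * r * (1 - sqrt 2)) / (r * (1 - sqrt 2) + 2 * \<sigma>) in
               \<gamma> \<in> {0<..<1 / \<tau>_low} \<and>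
               \<tau> \<in> {\<tau>_low<..<1 / \<gamma>} \<and>
               relax \<in> {0<..<2 * (1 - \<tau>_low / \<tau>)})"
    then obtain \<sigma> \<tau>\<^sub>0 where \<sigma>: "\<sigma> > r * (sqrt 2 - 1) / 2"
      and RCE: "semimonotone \<sigma> 0 R\<^sub>C" "semimonotone \<sigma> 0 R\<^sub>E"
      and \<tau>\<^sub>0_def: "\<tau>\<^sub>0 = - (\<sigma> * r * (1 - sqrt 2)) / (r * (1 - sqrt 2) + 2 * \<sigma>)"
      and par: "\<gamma> > 0" "\<tau>\<^sub>0 < \<tau>" "\<tau> < 1 / \<gamma>" "relax > 0" "relax < 2 * (1 - \<tau>\<^sub>0 / \<tau>)"
      unfolding strongly_monotone_op_def Let_def by auto
    define \<kappa> where "\<kappa> = r * (sqrt 2 - 1) / 2"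
    have \<kappa>: "0 < \<kappa>" "\<kappa> < \<sigma>" using r \<sigma> unfolding \<kappa>_def by simp_all
    have \<tau>\<^sub>0_eq: "\<tau>\<^sub>0 = \<sigma> * \<kappa> / (\<sigma> - \<kappa>)"
    proof -
      have "\<tau>\<^sub>0 = (2 * (\<sigma> * \<kappa>)) / (2 * (\<sigma> - \<kappa>))" unfolding \<tau>\<^sub>0_def \<kappa>_def
        by (rule arg_cong2[where f = "(/)"]) (simp_all add: right_diff_distrib diff_divide_distrib)
      then show ?thesis by (simp only: mult_divide_mult_cancel_left_if) simp
    qed
    have \<tau>\<^sub>0: "\<tau>\<^sub>0 > 0" unfolding \<tau>\<^sub>0_eq using \<kappa> by simp
    have \<tau>: "\<tau> > 0" using \<tau>\<^sub>0 par(2) by linarith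
    have \<gamma>\<tau>: "\<gamma> * \<tau> < 1" using par(1,3) by (simp add: field_simps)
    define l where "l = 1 - relax / 2"
    have "\<tau>\<^sub>0 / \<tau> < l" using divide_strict_right_mono[OF par(5), of 2] unfolding l_def by simp
    then have l\<tau>: "\<tau>\<^sub>0 < l * \<tau>" and l: "l > 0"
      using \<tau> divide_pos_pos[OF \<tau>\<^sub>0 \<tau>] by (simp add: pos_divide_less_eq, linarith)
    \<comment> \<open>\<open>\<kappa>\<close> is the positive root of \<open>(1 + 2 \<kappa>/r)\<^sup>2 = 8 \<kappa> (1/r + \<kappa>/r\<^sup>2)\<close>: even with the uniform
      transistor bound, \<open>G\<close> is \<open>(0, -\<kappa>)\<close>-semimonotone.\<close>
    have "(1 + 2 * \<kappa> / r)\<^sup>2 \<le> 8 * \<kappa> * (1 / r + \<kappa> / r\<^sup>2 - 0)"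
    proof -
      have "2 * \<kappa> / r = sqrt 2 - 1" unfolding \<kappa>_def using r by simp
      then have "1 + 2 * \<kappa> / r = sqrt 2" by simp
      moreover have "8 * \<kappa> * (1 / r + \<kappa> / r\<^sup>2 - 0) = 2 * ((1 + 2 * \<kappa> / r)\<^sup>2 - 1)"
        using r by (simp add: power2_eq_square algebra_simps)
      ultimately show ?thesis by simp
    qed
    from shunted_transistor_semimonotone[OF assms(1-3) r \<kappa>(1) this, folded G_def]
    obtain \<epsilon> where \<epsilon>: "\<epsilon> > 0" and G: "semimonotone (0 + \<epsilon>) (- \<kappa> + \<epsilon>) G" .
    define k where "k = \<kappa> - \<epsilon>"
    have k: "k < \<kappa>" unfolding k_def using \<epsilon> by simp
    have A: "\<sigma> - k > 0" using k \<kappa> by simp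
    \<comment> \<open>The matrix \<open>[[\<sigma> - k, -k], [-k, \<tau>\<^sub>0 - k]]\<close> is singular for \<open>k = \<kappa>\<close>; this is where \<open>\<tau>\<^sub>0\<close> comes
      from. The margin \<open>\<epsilon>\<close> makes it positive definite.\<close>
    have "\<sigma> * \<tau>\<^sub>0 = \<kappa> * (\<sigma> + \<tau>\<^sub>0)" unfolding \<tau>\<^sub>0_eq using \<kappa> by (simp add: field_simps)
    moreover have "k * (\<sigma> + \<tau>\<^sub>0) < \<kappa> * (\<sigma> + \<tau>\<^sub>0)" using k \<kappa> \<tau>\<^sub>0 by (intro mult_strict_right_mono) auto
    ultimately have "(\<sigma> - k) * (\<tau>\<^sub>0 - k) > (- k)\<^sup>2" by (simp add: algebra_simps power2_eq_square)
    with A obtain \<eta> where \<eta>: "\<eta> > 0"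
      and co: "\<And>x q :: real^2. \<eta> * ((norm x)\<^sup>2 + (norm q)\<^sup>2)
        \<le> (\<sigma> - k) * (norm x)\<^sup>2 + 2 * (- k) * (x \<bullet> q) + (\<tau>\<^sub>0 - k) * (norm q)\<^sup>2"
      using coercive_quadratic_form by blast
    show "\<exists>z. primal_dual_solution R G (mat 1) s\<^sub>v s\<^sub>i z \<and> (\<lambda>k. (i k, v k)) \<longlonglongrightarrow> z"
    proof (rule chambolle_pock_converges[where \<epsilon> = "min \<epsilon> \<eta>" and \<kappa>\<^sub>p = 0 and \<kappa>\<^sub>q = \<tau>\<^sub>0,
          OF par(1) \<tau> \<gamma>\<tau> par(4) _ Rcl G Gcl _ _ _ _ _ cp])
      show "semimonotone \<sigma> 0 R" unfolding R_def by (rule semimonotone_prod_op[OF RCE])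
      show "min \<epsilon> \<eta> > 0" using \<epsilon> \<eta> by simp
      show "min \<epsilon> \<eta> * (norm y)\<^sup>2 - 0 * (norm p)\<^sup>2 \<le> (0 + \<epsilon>) * (norm y)\<^sup>2 + 0 * (norm (p - y))\<^sup>2"
        for y p :: "real^2" by (simp add: mult_right_mono)
      show "min \<epsilon> \<eta> * (norm x)\<^sup>2 - \<tau>\<^sub>0 * (norm q)\<^sup>2 \<le> \<sigma> * (norm x)\<^sup>2 + (- \<kappa> + \<epsilon>) * (norm (q + x))\<^sup>2"
        for x q :: "real^2"
      proof -
        have "min \<epsilon> \<eta> * (norm x)\<^sup>2 \<le> \<eta> * (norm x)\<^sup>2" by (simp add: mult_right_mono)
        moreover have "0 \<le> \<eta> * (norm q)\<^sup>2" using \<eta> by simp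
        moreover have "\<sigma> * (norm x)\<^sup>2 + (- \<kappa> + \<epsilon>) * (norm (q + x))\<^sup>2 + \<tau>\<^sub>0 * (norm q)\<^sup>2
            = (\<sigma> - k) * (norm x)\<^sup>2 + 2 * (- k) * (x \<bullet> q) + (\<tau>\<^sub>0 - k) * (norm q)\<^sup>2"
          unfolding k_def
          by (simp add: power2_norm_eq_inner inner_simps inner_commute algebra_simps)
        ultimately show ?thesis using co[of x q] by (simp add: distrib_left)
      qed
      show "0 * (1 - \<gamma> * \<tau>) < (1 - relax / 2) * \<gamma>" using l par(1) unfolding l_def by simp
      have "(l * \<gamma>) * (\<tau>\<^sub>0 * (1 - \<gamma> * \<tau>)) < (l * \<gamma>) * (l * \<tau> * (1 - \<gamma> * \<tau>))"
        using l par(1) l\<tau> \<gamma>\<tau> by (intro mult_strict_left_mono mult_strict_right_mono) auto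
      then show "((1 - relax / 2) * \<gamma> * \<tau>)\<^sup>2
          < ((1 - relax / 2) * \<gamma> - 0 * (1 - \<gamma> * \<tau>)) * ((1 - relax / 2) * \<tau> - \<tau>\<^sub>0 * (1 - \<gamma> * \<tau>))"
        unfolding l_def[symmetric] by (simp add: algebra_simps power2_eq_square)
    qed
  next
    assume "semimonotone (9 / 8 * r) (- (1 / (8 * r))) R\<^sub>C \<and>
        semimonotone (9 / 8 * r) (- (1 / (8 * r))) R\<^sub>E \<and>
        \<gamma> \<in> {(5 - sqrt 10) / (9 * r)<..<(5 + sqrt 10) / (9 * r)} \<and>
        \<tau> \<in> {9 * r * (6 * r * \<gamma> - 1) / (51 * r * \<gamma> - 10)<..<1 / \<gamma>} \<and>
        (let \<Delta> = - (1 / (12 * r * \<gamma>)) - 9 * r / (20 * \<tau>) in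
           relax \<in> {0<..<2 * (1 + \<Delta> - sqrt (\<Delta>\<^sup>2 - 3 / (20 * \<gamma> * \<tau>) * (1 - \<gamma> * \<tau>)))})"
    then have RCE: "semimonotone (9 / 8 * r) (- (1 / (8 * r))) R\<^sub>C" "semimonotone (9 / 8 * r) (- (1 / (8 * r))) R\<^sub>E"
      and \<gamma>_low: "(5 - sqrt 10) / (9 * r) < \<gamma>"
      and \<tau>_low: "9 * r * (6 * r * \<gamma> - 1) / (51 * r * \<gamma> - 10) < \<tau>" and \<tau>_up: "\<tau> < 1 / \<gamma>"
      and relax: "relax > 0" "relax < 2 * (1 + (- (1 / (12 * r * \<gamma>)) - 9 * r / (20 * \<tau>))
        - sqrt ((- (1 / (12 * r * \<gamma>)) - 9 * r / (20 * \<tau>))\<^sup>2 - 3 / (20 * \<gamma> * \<tau>) * (1 - \<gamma> * \<tau>)))"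
      unfolding Let_def by auto
    \<comment> \<open>The lower bound on \<open>\<gamma>\<close> makes the denominator and the numerator of the lower bound on \<open>\<tau>\<close>
      positive, which is how \<open>\<tau> > 0\<close> is obtained.\<close>
    have "sqrt 10 < 5 - 90 / 51"
      by (rule real_less_lsqrt) (simp_all add: power2_eq_square)
    then have "90 / 51 / (9 * r) < (5 - sqrt 10) / (9 * r)" using r by (intro divide_strict_right_mono) auto
    then have "90 / 51 / (9 * r) < \<gamma>" using \<gamma>_low by linarith
    then have r\<gamma>: "51 * r * \<gamma> > 10" using r by (simp add: field_simps)
    then have \<gamma>: "\<gamma> > 0" using r by (smt (verit) mult_nonneg_nonpos)
    have "9 * r * (6 * r * \<gamma> - 1) / (51 * r * \<gamma> - 10) > 0" using r r\<gamma> by simp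
    then have \<tau>: "\<tau> > 0" using \<tau>_low by linarith
    have \<gamma>\<tau>: "\<gamma> * \<tau> < 1" using \<gamma> \<tau>_up by (simp add: field_simps)
    define l where "l = 1 - relax / 2"
    \<comment> \<open>\<open>P = \<kappa>\<^sub>p/\<gamma>\<close> and \<open>Q = \<kappa>\<^sub>q/\<tau>\<close>. The upper bound on the relaxation parameter says that \<open>l\<close> exceeds
      the larger root of \<open>l\<^sup>2 - l (P + Q) + det\<close>, the characteristic polynomial of the preconditioner
      times \<open>diag(\<kappa>\<^sub>p, \<kappa>\<^sub>q)\<close>.\<close>
    define P Q where "P = 1 / (6 * r * \<gamma>)" and "Q = 9 * r / (10 * \<tau>)"
    have PQ: "P > 0" "Q > 0" unfolding P_def Q_def using r \<gamma> \<tau> by simp_all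
    define det where "det = P * Q * (1 - \<gamma> * \<tau>)"
    have det: "3 / (20 * \<gamma> * \<tau>) * (1 - \<gamma> * \<tau>) = det"
      unfolding det_def P_def Q_def using r by simp
    have \<Delta>: "- (1 / (12 * r * \<gamma>)) - 9 * r / (20 * \<tau>) = - ((P + Q) / 2)"
      unfolding P_def Q_def by (simp add: field_simps)
    have "relax < 2 * (1 + - ((P + Q) / 2) - sqrt (((P + Q) / 2)\<^sup>2 - det))"
      using relax(2) unfolding \<Delta> det power2_minus .
    then have l_gt: "l > (P + Q) / 2 + sqrt (((P + Q) / 2)\<^sup>2 - det)"
      unfolding l_def by argo
    have disc: "((P + Q) / 2)\<^sup>2 - det = ((P - Q) / 2)\<^sup>2 + P * Q * (\<gamma> * \<tau>)"
      unfolding det_def by (simp add: power2_eq_square field_simps)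
    have sq: "sqrt (((P + Q) / 2)\<^sup>2 - det) > (P - Q) / 2"
    proof -
      have "sqrt (((P - Q) / 2)\<^sup>2) < sqrt (((P + Q) / 2)\<^sup>2 - det)"
        unfolding disc using PQ \<gamma> \<tau> by (intro real_sqrt_less_mono) simp
      then show ?thesis unfolding real_sqrt_abs using abs_ge_self[of "(P - Q) / 2"] by argo
    qed
    have ge: "((P + Q) / 2)\<^sup>2 - det \<ge> 0" unfolding disc using PQ \<gamma> \<tau> by simp
    have lP: "l > P" and lt: "l - (P + Q) / 2 > sqrt (((P + Q) / 2)\<^sup>2 - det)"
      using l_gt sq by argo+
    have "(sqrt (((P + Q) / 2)\<^sup>2 - det))\<^sup>2 < (l - (P + Q) / 2)\<^sup>2"
      using lt ge by (intro power_strict_mono) auto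
    then have root: "0 < l\<^sup>2 - l * (P + Q) + det"
      using ge by (simp add: power2_eq_square field_simps)
    \<comment> \<open>Both sides equal 4: \<open>G\<close> is \<open>(1/(2 r), -r/2)\<close>-semimonotone even with the uniform transistor
      bound.\<close>
    have "(1 + 2 * (r / 2) / r)\<^sup>2 \<le> 8 * (r / 2) * (1 / r + r / 2 / r\<^sup>2 - 1 / (2 * r))"
      using r by (simp add: field_simps power2_eq_square)
    from shunted_transistor_semimonotone[OF assms(1-3) r half_gt_zero[OF r] this, folded G_def]
    obtain \<epsilon> where \<epsilon>: "\<epsilon> > 0" and G: "semimonotone (1 / (2 * r) + \<epsilon>) (- (r / 2) + \<epsilon>) G" .
    \<comment> \<open>For \<open>\<epsilon> = 0\<close> this form is \<open>(r/40) |5 x - 4 q|\<^sup>2\<close>, which is only semidefinite.\<close>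
    have "5 / 8 * r + \<epsilon> > 0" "(5 / 8 * r + \<epsilon>) * (2 / 5 * r + \<epsilon>) > (- (r / 2) + \<epsilon>)\<^sup>2"
      using r \<epsilon> by (simp_all add: power2_eq_square field_simps add_pos_pos)
    then obtain \<eta> where \<eta>: "\<eta> > 0"
      and co: "\<And>x q :: real^2. \<eta> * ((norm x)\<^sup>2 + (norm q)\<^sup>2)
        \<le> (5 / 8 * r + \<epsilon>) * (norm x)\<^sup>2 + 2 * (- (r / 2) + \<epsilon>) * (x \<bullet> q) + (2 / 5 * r + \<epsilon>) * (norm q)\<^sup>2"
      using coercive_quadratic_form by blast
    show "\<exists>z. primal_dual_solution R G (mat 1) s\<^sub>v s\<^sub>i z \<and> (\<lambda>k. (i k, v k)) \<longlonglongrightarrow> z"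
    proof (rule chambolle_pock_converges[where \<epsilon> = "min \<epsilon> \<eta>" and \<kappa>\<^sub>p = "1 / (6 * r)" and \<kappa>\<^sub>q = "9 / 10 * r",
          OF \<gamma> \<tau> \<gamma>\<tau> relax(1) _ Rcl G Gcl _ _ _ _ _ cp])
      show "semimonotone (9 / 8 * r) (- (1 / (8 * r))) R" unfolding R_def by (rule semimonotone_prod_op[OF RCE])
      show "min \<epsilon> \<eta> > 0" using \<epsilon> \<eta> by simp
      show "min \<epsilon> \<eta> * (norm y)\<^sup>2 - 1 / (6 * r) * (norm p)\<^sup>2
          \<le> (1 / (2 * r) + \<epsilon>) * (norm y)\<^sup>2 + - (1 / (8 * r)) * (norm (p - y))\<^sup>2" for y p :: "real^2"
      proof -
        have "0 \<le> 1 / (24 * r) * (norm (3 *\<^sub>R y + p))\<^sup>2" using r by simp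
        also have "\<dots> = 1 / (2 * r) * (norm y)\<^sup>2 - 1 / (8 * r) * (norm (p - y))\<^sup>2 + 1 / (6 * r) * (norm p)\<^sup>2"
          using r by (simp add: power2_norm_eq_inner inner_simps inner_commute field_simps)
        finally show ?thesis
          using mult_right_mono[OF min.cobounded1[of \<epsilon> \<eta>], of "(norm y)\<^sup>2"] by (simp add: distrib_right)
      qed
      show "min \<epsilon> \<eta> * (norm x)\<^sup>2 - 9 / 10 * r * (norm q)\<^sup>2
          \<le> 9 / 8 * r * (norm x)\<^sup>2 + (- (r / 2) + \<epsilon>) * (norm (q + x))\<^sup>2" for x q :: "real^2"
      proof -
        have "min \<epsilon> \<eta> * (norm x)\<^sup>2 \<le> \<eta> * (norm x)\<^sup>2" by (simp add: mult_right_mono)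
        moreover have "0 \<le> \<eta> * (norm q)\<^sup>2" using \<eta> by simp
        moreover have "9 / 8 * r * (norm x)\<^sup>2 + (- (r / 2) + \<epsilon>) * (norm (q + x))\<^sup>2 + 9 / 10 * r * (norm q)\<^sup>2
            = (5 / 8 * r + \<epsilon>) * (norm x)\<^sup>2 + 2 * (- (r / 2) + \<epsilon>) * (x \<bullet> q) + (2 / 5 * r + \<epsilon>) * (norm q)\<^sup>2"
          by (simp add: power2_norm_eq_inner inner_simps inner_commute field_simps)
        ultimately show ?thesis using co[of x q] by (simp add: distrib_left)
      qed
      have P: "1 / (6 * r) = P * \<gamma>" and Q: "9 / 10 * r = Q * \<tau>"
        unfolding P_def Q_def using \<gamma> \<tau> by simp_all
      have "P * (1 - \<gamma> * \<tau>) < P" using PQ \<gamma> \<tau> by (simp add: algebra_simps)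
      then have "P * (1 - \<gamma> * \<tau>) * \<gamma> < l * \<gamma>" using lP \<gamma> by (intro mult_strict_right_mono) auto
      then show "1 / (6 * r) * (1 - \<gamma> * \<tau>) < (1 - relax / 2) * \<gamma>"
        unfolding l_def[symmetric] P by (simp add: mult_ac)
      have "0 < \<gamma> * \<tau> * (1 - \<gamma> * \<tau>) * (l\<^sup>2 - l * (P + Q) + det)"
        using \<gamma> \<tau> \<gamma>\<tau> root by simp
      also have "\<dots> = (l * \<gamma> - P * \<gamma> * (1 - \<gamma> * \<tau>)) * (l * \<tau> - Q * \<tau> * (1 - \<gamma> * \<tau>)) - (l * \<gamma> * \<tau>)\<^sup>2"
        unfolding det_def by (simp add: power2_eq_square algebra_simps)
      finally show "((1 - relax / 2) * \<gamma> * \<tau>)\<^sup>2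
          < ((1 - relax / 2) * \<gamma> - 1 / (6 * r) * (1 - \<gamma> * \<tau>)) * ((1 - relax / 2) * \<tau> - 9 / 10 * r * (1 - \<gamma> * \<tau>))"
        unfolding l_def[symmetric] P Q by simp
    qed
  qed
qed

end
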